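(* Let $M$ be a compact PL manifold and let $p:\widetilde M\to M$ be a $d$-sheeted (finite) covering. Then $c(\widetilde M)\leqslant d\cdot c(M)$.
   Context: All manifolds, maps and subpolyhedra are piecewise-linear (PL); manifolds are compact, of dimension $n\geqslant 1$, possibly with boundary. Local model. Let $\Delta^{m+1}$ be the $(m+1)$-simplex. $\Pi^m\subset\Delta^{m+1}\cong D^{m+1}$ is the cone (with apex the barycenter) over the $(m-1)$-skeleton of $\Delta^{m+1}$ (for $m=0$, $\Pi^0$ is a point). For $0\leqslant k\leqslant m$ put $\Pi^m_k=\Pi^{m-k}\times D^k\subset D^{m-k+1}\times D^k\cong D^{m+1}$ and $\partial\Pi^m_k=\Pi^m_k\cap S^m$, where $S^m=\partial D^{m+1}$. A compact polyhedron $P$ of dimension $m$ is simple if the link of every point of $P$ is homeomorphic to $\partial \Pi^m_k$ for some $k$ (the point is then "of type $k$"). A vertex of $P$ is a point of type $0$. Every simple polyhedron $P$ in the interior of an $n$-manifold $M$ is assumed to have dimension $n-1$ and to be locally unknotted: for every $x\in P$ the maximal $t$ such that the link of $x$ in $(M,P)$ is a $t$-fold suspension of a pair equals the maximal $t$ such that the link of $x$ in $P$ is a $t$-fold suspension (equivalently, the link of every $x\in P$ in $(M,P)$ is homeomorphic to $(S^{n-1},\partial\Pi^{n-1}_k)$ for some $k$). Spine and complexity. A subpolyhedron $P\subset \mathrm{int}(M)$ is a spine of $M$ if there are finitely many (possibly zero) disjoint $n$-discs $D_1,\ldots,D_r\subset\mathrm{int}(M)$, disjoint from $P$, such that $M\setminus\mathrm{int}(D_1\cup\ldots\cup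 D_r)$ collapses onto $P$. The complexity $c(M)$ is the minimum number of vertices of a simple spine of $M$. *)

theory Defs
  imports "HOL-Analysis.Analysis" "HOL-Library.Extended_Nat"
begin

text \<open>
  Compact PL spaces are represented by compact polyhedra in Euclidean spaces; every compact PL
  manifold is of this form. The word ``polyhedron'' is used in the sense of PL topology, not in the
  sense of \<^const>\<open>polyhedron\<close>, which is a finite intersection of half-spaces.
\<close>

section \<open>Polyhedra and PL maps\<close>

definition compact_polyhedron :: "'a::euclidean_space set \<Rightarrow> bool" where
  "compact_polyhedron X \<longleftrightarrow> (\<exists>F. finite F \<and> (\<forall>C\<in>F. polytope C) \<and> \<Union>F = X)"

text \<open>The set of affine dimensions is finite and contains \<open>-1\<close>, coming from the empty polytope.\<close>

definition polyhedron_dim :: "'a::euclidean_space set \<Rightarrow> int" where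
  "polyhedron_dim X = Max (aff_dim ` {C. polytope C \<and> C \<subseteq> X})"

definition affine_map_on ::
  "'a::euclidean_space set \<Rightarrow> ('a \<Rightarrow> 'b::euclidean_space) \<Rightarrow> bool" where
  "affine_map_on C f \<longleftrightarrow> (\<exists>h b. linear h \<and> (\<forall>x\<in>C. f x = h x + b))"

definition pl_on :: "'a::euclidean_space set \<Rightarrow> ('a \<Rightarrow> 'b::euclidean_space) \<Rightarrow> bool" where
  "pl_on X f \<longleftrightarrow>
     (\<exists>F. finite F \<and> (\<forall>C\<in>F. polytope C) \<and> \<Union>F = X \<and> (\<forall>C\<in>F. affine_map_on C f))"

definition pl_homeomorphism ::
  "'a::euclidean_space set \<Rightarrow> 'b::euclidean_space set \<Rightarrow> ('a \<Rightarrow> 'b) \<Rightarrow> ('b \<Rightarrow> 'a) \<Rightarrow> bool" where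
  "pl_homeomorphism X Y f g \<longleftrightarrow> homeomorphism X Y f g \<and> pl_on X f \<and> pl_on Y g"

definition pl_homeomorphic ::
  "'a::euclidean_space set \<Rightarrow> 'b::euclidean_space set \<Rightarrow> bool" where
  "pl_homeomorphic X Y \<longleftrightarrow> (\<exists>f g. pl_homeomorphism X Y f g)"

definition pl_homeomorphic_pair ::
  "'a::euclidean_space set \<Rightarrow> 'a set \<Rightarrow> 'b::euclidean_space set \<Rightarrow> 'b set \<Rightarrow> bool" where
  "pl_homeomorphic_pair X A Y B \<longleftrightarrow> (\<exists>f g. pl_homeomorphism X Y f g \<and> f ` A = B)"

section \<open>Manifolds\<close>

definition nbhd_in :: "'a::topological_space set \<Rightarrow> 'a \<Rightarrow> 'a set \<Rightarrow> bool" where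
  "nbhd_in X x N \<longleftrightarrow> N \<subseteq> X \<and> (\<exists>U. openin (top_of_set X) U \<and> x \<in> U \<and> U \<subseteq> N)"

text \<open>
  A subset of \<^typ>\<open>'a\<close> homeomorphic to an \<open>n\<close>-simplex forces \<open>n \<le> DIM('a)\<close>, so the model simplex can
  be taken in the same type.
\<close>

definition pl_ball :: "nat \<Rightarrow> 'a::euclidean_space set \<Rightarrow> bool" where
  "pl_ball n B \<longleftrightarrow> (\<exists>\<Delta> :: 'a set. int n simplex \<Delta> \<and> pl_homeomorphic B \<Delta>)"

definition pl_manifold :: "nat \<Rightarrow> 'a::euclidean_space set \<Rightarrow> bool" where
  "pl_manifold n M \<longleftrightarrow> compact_polyhedron M \<and> (\<forall>x\<in>M. \<exists>N. nbhd_in M x N \<and> pl_ball n N)"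

definition pl_interior :: "nat \<Rightarrow> 'a::euclidean_space set \<Rightarrow> 'a set" where
  "pl_interior n M =
     {x \<in> M. \<exists>N f g. \<exists>\<Delta> :: 'a set. nbhd_in M x N \<and> int n simplex \<Delta> \<and>
        pl_homeomorphism N \<Delta> f g \<and> f x \<in> rel_interior \<Delta>}"

definition pl_boundary :: "nat \<Rightarrow> 'a::euclidean_space set \<Rightarrow> 'a set" where
  "pl_boundary n M = M - pl_interior n M"

section \<open>Cones, links and suspensions\<close>

text \<open>The cone over the empty set is its apex.\<close>

definition pl_cone :: "'a::real_vector \<Rightarrow> 'a set \<Rightarrow> 'a set" where
  "pl_cone a K = insert a (\<Union>y\<in>K. closed_segment a y)"

text \<open>
  \<open>L\<close> is a link of \<open>x\<close> in \<open>X\<close> if the cone with apex \<open>x\<close> over \<open>L\<close> is embedded and is a neighbourhood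
  (a star) of \<open>x\<close> in \<open>X\<close>. Links are unique up to PL homeomorphism.
\<close>

definition is_link :: "'a::euclidean_space \<Rightarrow> 'a set \<Rightarrow> 'a set \<Rightarrow> bool" where
  "is_link x X L \<longleftrightarrow> compact_polyhedron L \<and> x \<notin> L \<and>
     (\<forall>y\<in>L. \<forall>z\<in>L. y \<noteq> z \<longrightarrow> closed_segment x y \<inter> closed_segment x z = {x}) \<and>
     nbhd_in X x (pl_cone x L)"

definition is_link_pair ::
  "'a::euclidean_space \<Rightarrow> 'a set \<Rightarrow> 'a set \<Rightarrow> 'a set \<Rightarrow> 'a set \<Rightarrow> bool" where
  "is_link_pair x M P L L' \<longleftrightarrow> is_link x M L \<and> is_link x P L' \<and> L' \<subseteq> L"

definition suspension :: "'a::real_vector set \<Rightarrow> ('a \<times> real) set" where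
  "suspension Y = pl_cone (0, 1) (Y \<times> {0}) \<union> pl_cone (0, -1) (Y \<times> {0})"

text \<open>
  If \<open>X\<close> is homeomorphic to the suspension of \<open>Y\<close> then \<open>Y\<close> embeds in \<open>X\<close>, so quantifying over
  desuspensions \<open>Y\<close> in the type of \<open>X\<close> is no restriction.
\<close>

primrec is_suspension :: "nat \<Rightarrow> 'a::euclidean_space set \<Rightarrow> bool" where
  "is_suspension 0 X \<longleftrightarrow> compact_polyhedron X"
| "is_suspension (Suc t) X \<longleftrightarrow>
     (\<exists>Y :: 'a set. is_suspension t Y \<and> pl_homeomorphic X (suspension Y))"

primrec is_suspension_pair :: "nat \<Rightarrow> 'a::euclidean_space set \<Rightarrow> 'a set \<Rightarrow> bool" where
  "is_suspension_pair 0 X A \<longleftrightarrow> compact_polyhedron X \<and> compact_polyhedron A \<and> A \<subseteq> X"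
| "is_suspension_pair (Suc t) X A \<longleftrightarrow>
     (\<exists>(Y :: 'a set) B. is_suspension_pair t Y B \<and>
        pl_homeomorphic_pair X A (suspension Y) (suspension B))"

section \<open>Simple polyhedra\<close>

definition barycenter :: "'a::euclidean_space set \<Rightarrow> 'a" where
  "barycenter \<Delta> = (\<Sum>v | v extreme_point_of \<Delta>. v) /\<^sub>R real (card {v. v extreme_point_of \<Delta>})"

text \<open>For an \<open>(m+1)\<close>-simplex \<open>\<Delta>\<close> this is \<open>\<Pi>\<^sup>m\<close>, the cone over the \<open>(m-1)\<close>-skeleton.\<close>

definition Pi_model :: "'a::euclidean_space set \<Rightarrow> 'a set" where
  "Pi_model \<Delta> =
     pl_cone (barycenter \<Delta>) (\<Union>{F. F face_of \<Delta> \<and> aff_dim F \<le> aff_dim \<Delta> - 2})"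

text \<open>
  For an \<open>(m-k+1)\<close>-simplex \<open>\<Delta>\<close> and a \<open>k\<close>-simplex \<open>T\<close> this is the boundary of \<open>\<Pi>\<^sup>m\<close> of type \<open>k\<close>, with
  \<open>\<Delta> \<times> T\<close> as the disc of dimension \<open>m+1\<close>.
\<close>

definition bd_Pi_model ::
  "'a::euclidean_space set \<Rightarrow> 'b::euclidean_space set \<Rightarrow> ('a \<times> 'b) set" where
  "bd_Pi_model \<Delta> T = (Pi_model \<Delta> \<times> T) \<inter> rel_frontier (\<Delta> \<times> T)"

text \<open>
  The factor \<^typ>\<open>real\<close> guarantees that the model exists in the given type whenever
  \<open>m \<le> DIM('a)\<close>, in particular for every \<open>m\<close>-dimensional polyhedron in \<^typ>\<open>'a\<close>.
\<close>

definition point_of_type :: "nat \<Rightarrow> nat \<Rightarrow> 'a::euclidean_space set \<Rightarrow> 'a \<Rightarrow> bool" where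
  "point_of_type m k P x \<longleftrightarrow> x \<in> P \<and> k \<le> m \<and>
     (\<exists>L (\<Delta> :: ('a \<times> real) set) (T :: 'a set).
        is_link x P L \<and> int (m - k + 1) simplex \<Delta> \<and> int k simplex T \<and>
        pl_homeomorphic L (bd_Pi_model \<Delta> T))"

definition simple_polyhedron :: "nat \<Rightarrow> 'a::euclidean_space set \<Rightarrow> bool" where
  "simple_polyhedron m P \<longleftrightarrow> compact_polyhedron P \<and> polyhedron_dim P = int m \<and>
     (\<forall>x\<in>P. \<exists>k\<le>m. point_of_type m k P x)"

definition vertices :: "nat \<Rightarrow> 'a::euclidean_space set \<Rightarrow> 'a set" where
  "vertices m P = {x. point_of_type m 0 P x}"

text \<open>Both sets of exponents are finite, since a \<open>t\<close>-fold suspension has dimension at least \<open>t-1\<close>.\<close>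

definition locally_unknotted :: "'a::euclidean_space set \<Rightarrow> 'a set \<Rightarrow> bool" where
  "locally_unknotted M P \<longleftrightarrow>
     (\<forall>x\<in>P. \<exists>L L'. is_link_pair x M P L L' \<and>
        Max {t. is_suspension_pair t L L'} = Max {t. is_suspension t L'})"

section \<open>Collapses, spines and complexity\<close>

definition elementary_collapse :: "'a::euclidean_space set \<Rightarrow> 'a set \<Rightarrow> bool" where
  "elementary_collapse X Y \<longleftrightarrow> compact_polyhedron X \<and> compact_polyhedron Y \<and>
     (\<exists>k B. pl_ball (Suc k) B \<and> X = Y \<union> B \<and>
        pl_ball k (Y \<inter> B) \<and> Y \<inter> B \<subseteq> pl_boundary (Suc k) B)"

definition collapses_onto :: "'a::euclidean_space set \<Rightarrow> 'a set \<Rightarrow> bool" where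
  "collapses_onto = elementary_collapse\<^sup>*\<^sup>*"

definition is_spine :: "nat \<Rightarrow> 'a::euclidean_space set \<Rightarrow> 'a set \<Rightarrow> bool" where
  "is_spine n M P \<longleftrightarrow> compact_polyhedron P \<and> P \<subseteq> pl_interior n M \<and>
     (\<exists>\<D>. finite \<D> \<and> pairwise disjnt \<D> \<and>
        (\<forall>D\<in>\<D>. pl_ball n D \<and> D \<subseteq> pl_interior n M \<and> disjnt D P) \<and>
        collapses_onto (M - (\<Union>D\<in>\<D>. pl_interior n D)) P)"

definition simple_spine :: "nat \<Rightarrow> 'a::euclidean_space set \<Rightarrow> 'a set \<Rightarrow> bool" where
  "simple_spine n M P \<longleftrightarrow>
     is_spine n M P \<and> simple_polyhedron (n - 1) P \<and> locally_unknotted M P"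

text \<open>
  The value \<open>\<infinity>\<close> encodes the absence of a simple spine with finitely many vertices; the infimum is a
  minimum otherwise.
\<close>

definition ecard :: "'a set \<Rightarrow> enat" where
  "ecard A = (if finite A then enat (card A) else \<infinity>)"

definition complexity :: "nat \<Rightarrow> 'a::euclidean_space set \<Rightarrow> enat" where
  "complexity n M = (INF P \<in> {P. simple_spine n M P}. ecard (vertices (n - 1) P))"

section \<open>Coverings\<close>

text \<open>The total space carries the lifted PL structure, i.e. the covering map is PL.\<close>

definition pl_covering ::
  "nat \<Rightarrow> 'b::euclidean_space set \<Rightarrow> ('b \<Rightarrow> 'a::euclidean_space) \<Rightarrow> 'a set \<Rightarrow> bool" where
  "pl_covering d M' p M \<longleftrightarrow> 1 \<le> d \<and> covering_space M' p M \<and> pl_on M' p \<and>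
     (\<forall>x\<in>M. finite {y\<in>M'. p y = x} \<and> card {y\<in>M'. p y = x} = d)"

end

(*
  Given a simple spine P of M, its preimage P' is a simple spine of M', and the vertices of P' lie
  over those of P, so there are at most d times as many.  Since p is a local PL homeomorphism that is
  linear along short rays, it carries a shrunken star of a point of P' to a star of its image, and
  so does its local inverse; hence point types and local unknottedness agree upstairs and downstairs
  without any appeal to the uniqueness of links.  Balls are simply connected, so each ball of M lifts
  to finitely many disjoint balls: this lifts the removed discs, and every elementary collapse lifts
  to a sequence of elementary collapses, one for each sheet.
*)

theory Submission
  imports Defs
begin

section \<open>Affine maps\<close>

text \<open>Two features of the definitions shape the proof. Models live in prescribed types: a
  ball, an interior point, a point type or a desuspension refers to simplices or sets in a type
  fixed by the space at hand, while \<open>p\<close> relates two different types. Transport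
  therefore has to produce new models on the target side, and for simplices a dimension bound must
  guarantee room; hence the material on dimension and on affine isomorphisms of simplices. Secondly,
  links are literal: the segments from the point form an embedded cone, and a PL map may bend long
  segments, so only a sufficiently small copy of a link need have a link as its image. The scale is
  left free below a bound so that one scale can serve \<open>M\<close> and \<open>P\<close>
  together, which keeps the link in \<open>P\<close> inside the link in \<open>M\<close>. Finally,
  the lifts of a ball supplied by covering theory are merely continuous; their images are polyhedral
  because they are separated pieces of the polyhedron lying over the ball.\<close>

lemma affine_map_onI:
  assumes "linear h" "\<And>x. x \<in> C \<Longrightarrow> f x = h x + b"
  shows "affine_map_on C f"
  using assms unfolding affine_map_on_def by blast

lemma affine_map_on_subset: "affine_map_on C f \<Longrightarrow> D \<subseteq> C \<Longrightarrow> affine_map_on D f"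
  unfolding affine_map_on_def by blast

lemma affine_map_on_compose:
  assumes "affine_map_on C f" "affine_map_on D g" "f ` C \<subseteq> D"
  shows "affine_map_on C (\<lambda>x. g (f x))"
proof -
  obtain h b where h: "linear h" "\<And>x. x \<in> C \<Longrightarrow> f x = h x + b"
    using assms(1) unfolding affine_map_on_def by blast
  obtain k c where k: "linear k" "\<And>x. x \<in> D \<Longrightarrow> g x = k x + c"
    using assms(2) unfolding affine_map_on_def by blast
  show ?thesis
  proof (rule affine_map_onI)
    show "linear (k \<circ> h)" using h k linear_compose by blast
    fix x assume "x \<in> C"
    then show "g (f x) = (k \<circ> h) x + (k b + c)"
      using h k assms(3) by (simp add: image_subset_iff linear_add)
  qed
qed

lemma affine_map_on_convex_combination:
  assumes "affine_map_on C f" "x \<in> C" "y \<in> C" "x + t *\<^sub>R (y - x) \<in> C"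
  shows "f (x + t *\<^sub>R (y - x)) = f x + t *\<^sub>R (f y - f x)"
proof -
  obtain h b where h: "linear h" "\<And>x. x \<in> C \<Longrightarrow> f x = h x + b"
    using assms(1) unfolding affine_map_on_def by blast
  show ?thesis using assms(2-) h
    by (simp add: linear_add linear_diff linear_scale)
qed

lemma affine_map_on_image_translation:
  assumes "affine_map_on C f"
  obtains h b where "linear h" "\<And>x. x \<in> C \<Longrightarrow> f x = h x + b"
    "\<And>D. D \<subseteq> C \<Longrightarrow> f ` D = (+) b ` (h ` D)"
proof -
  obtain h b where h: "linear h" "\<And>x. x \<in> C \<Longrightarrow> f x = h x + b"
    using assms(1) unfolding affine_map_on_def by blast
  have "f ` D = (+) b ` (h ` D)" if "D \<subseteq> C" for D
    unfolding image_image using h(2) that by (intro image_cong) (auto simp: add.commute)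
  with h that show ?thesis by blast
qed

lemma polytope_affine_image:
  assumes "polytope C" "affine_map_on C f"
  shows "polytope (f ` C)"
  using affine_map_on_image_translation[OF assms(2)] assms(1) polytope_linear_image
    polytope_translation_eq by (metis order_refl)

text \<open>The set is the projection of \<open>C \<times> D\<close> cut by the graph of a global
  affine extension of \<open>f\<close>; the graph is an affine subspace, hence a polyhedron.\<close>

lemma polytope_affine_vimage:
  assumes "polytope C" "polytope D" "affine_map_on C f"
  shows "polytope {x \<in> C. f x \<in> D}"
proof -
  obtain h b where h: "linear h" "\<And>x. x \<in> C \<Longrightarrow> f x = h x + b"
    using assms(3) unfolding affine_map_on_def by blast
  let ?G = "{z. snd z = h (fst z) + b}"
  have "affine ?G"
    unfolding affine_def using h(1)
    by (auto simp: linear_add linear_scale algebra_simps simp flip: scaleR_add_left)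
  then have "polytope (C \<times> D \<inter> ?G)"
    using assms by (intro polytope_Int_polyhedron polytope_Times affine_imp_polyhedron)
  then have "polytope (fst ` (C \<times> D \<inter> ?G))"
    by (rule polytope_linear_image[OF linear_fst])
  also have "fst ` (C \<times> D \<inter> ?G) = {x \<in> C. f x \<in> D}"
    using h(2) by (force simp: image_iff)
  finally show ?thesis .
qed

text \<open>A relative interior point of \<open>C\<close> can be moved a little in every direction
  of the span \<open>V\<close>, so injectivity of \<open>f\<close> on \<open>C\<close> forces its
  linear part to be injective on \<open>V\<close>. A linear left inverse on \<open>V\<close> then
  gives the affine formula for \<open>g\<close>.\<close>

lemma affine_map_on_inverse:
  assumes "affine_map_on C f" "convex C" "inj_on f C" "\<And>x. x \<in> C \<Longrightarrow> g (f x) = x"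
  shows "affine_map_on (f ` C) g"
proof (cases "C = {}")
  case True
  then show ?thesis by (auto intro: affine_map_onI[OF linear_zero])
next
  case False
  obtain h b where h: "linear h" "\<And>x. x \<in> C \<Longrightarrow> f x = h x + b"
    using assms(1) unfolding affine_map_on_def by blast
  obtain c where c: "c \<in> rel_interior C" using False assms(2) rel_interior_eq_empty by blast
  then have cC: "c \<in> C" using rel_interior_subset by blast
  define V where "V = span ((\<lambda>x. x - c) ` C)"
  have V: "subspace V" unfolding V_def by simp
  have "inj_on h V"
    unfolding linear_inj_on_iff_eq_0[OF h(1) V]
  proof (intro ballI impI)
    fix v assume v: "v \<in> V" "h v = 0"
    obtain e where e: "e > 0" "cball c e \<inter> affine hull C \<subseteq> C"
      using c mem_rel_interior_cball by blast
    have "affine hull C = (+) c ` V"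
    proof -
      have "affine hull C = (+) c ` span ((\<lambda>x. - c + x) ` C)"
        using affine_hull_span_gen[of c C] cC by (auto simp: hull_inc)
      then show ?thesis unfolding V_def by simp
    qed
    \<comment> \<open>The factor makes \<open>t *\<^sub>R v\<close> no longer than \<open>e\<close>;
      the added 1 keeps the denominator positive when \<open>v = 0\<close>.\<close>
    moreover define t where "t = e / (norm v + 1)"
    have t: "t > 0" unfolding t_def using e by (simp add: add_nonneg_pos)
    have "norm (t *\<^sub>R v) \<le> e"
      unfolding t_def using e(1) by (simp add: divide_le_eq add_nonneg_pos mult_left_mono)
    ultimately have "c + t *\<^sub>R v \<in> C"
      using e(2) v(1) V by (auto simp: dist_norm subspace_scale)
    moreover have "h (c + t *\<^sub>R v) = h c" using v(2) h(1) by (simp add: linear_add linear_scale)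
    ultimately have "f (c + t *\<^sub>R v) = f c" using h(2) cC by simp
    then have "c + t *\<^sub>R v = c" using assms(3) \<open>c + t *\<^sub>R v \<in> C\<close> cC by (meson inj_onD)
    then show "v = 0" using t by simp
  qed
  then obtain k where k: "linear k" "\<And>v. v \<in> V \<Longrightarrow> k (h v) = v"
    using linear_exists_left_inverse_on[OF h(1) V] by blast
  show ?thesis
  proof (rule affine_map_onI[OF k(1)])
    fix y assume "y \<in> f ` C"
    then obtain x where x: "x \<in> C" "y = f x" by blast
    have "x - c \<in> V" unfolding V_def using x by (simp add: span_base)
    then have "k (h (x - c)) = x - c" using k by blast
    then have "k (f x) - k (f c) = x - c"
      using h x cC k(1) by (simp add: linear_diff linear_add)
    then show "g y = k y + (c - k (f c))"
      using assms(4) x by (simp add: algebra_simps)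
  qed
qed

lemma aff_dim_affine_image_le:
  assumes "affine_map_on C f"
  shows "aff_dim (f ` C) \<le> aff_dim C"
  using affine_map_on_image_translation[OF assms] aff_dim_linear_image_le aff_dim_translation_eq
  by (metis order_refl)

lemma aff_dim_affine_image:
  assumes "affine_map_on C f" "convex C" "inj_on f C"
  shows "aff_dim (f ` C) = aff_dim C"
proof -
  have "affine_map_on (f ` C) (inv_into C f)"
    using assms by (intro affine_map_on_inverse) auto
  from aff_dim_affine_image_le[OF this] show ?thesis
    using aff_dim_affine_image_le[OF assms(1)] assms(3) by (simp add: image_inv_into_cancel)
qed

lemma continuous_on_affine_map: "affine_map_on C f \<Longrightarrow> continuous_on C f"
proof -
  assume "affine_map_on C f"
  then obtain h b where h: "linear h" "\<And>x. x \<in> C \<Longrightarrow> f x = h x + b"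
    unfolding affine_map_on_def by blast
  have "continuous_on C (\<lambda>x. h x + b)"
    using h(1) by (intro continuous_intros linear_continuous_on linear_conv_bounded_linear[THEN iffD1])
  then show ?thesis using h(2) continuous_on_cong by fastforce
qed

section \<open>Compact polyhedra and PL maps\<close>

lemma compact_polyhedron_polytope: "polytope C \<Longrightarrow> compact_polyhedron C"
  unfolding compact_polyhedron_def by (rule exI[of _ "{C}"]) auto

lemma compact_polyhedron_UN:
  assumes "finite I" "\<And>i. i \<in> I \<Longrightarrow> compact_polyhedron (X i)"
  shows "compact_polyhedron (\<Union>i\<in>I. X i)"
proof -
  obtain F where F: "\<And>i. i \<in> I \<Longrightarrow> finite (F i) \<and> (\<forall>C\<in>F i. polytope C) \<and> \<Union>(F i) = X i"
    using assms(2) unfolding compact_polyhedron_def by metis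
  have "\<Union>(\<Union>i\<in>I. F i) = (\<Union>i\<in>I. \<Union>(F i))" by blast
  also have "\<dots> = (\<Union>i\<in>I. X i)" using F by (metis (no_types, lifting) SUP_cong)
  finally show ?thesis unfolding compact_polyhedron_def
    using assms(1) F by (metis UN_E finite_UN)
qed

lemma compact_polyhedron_Un:
  assumes "compact_polyhedron X" "compact_polyhedron Y"
  shows "compact_polyhedron (X \<union> Y)"
  using compact_polyhedron_UN[of "{X, Y}" id] assms by auto

lemma compact_polyhedron_compact: "compact_polyhedron X \<Longrightarrow> compact X"
  unfolding compact_polyhedron_def by (metis compact_Union polytope_imp_compact)

lemma compact_polyhedron_Int:
  assumes "compact_polyhedron X" "compact_polyhedron Y"
  shows "compact_polyhedron (X \<inter> Y)"
proof -
  obtain F G where F: "finite F" "\<forall>C\<in>F. polytope C" "\<Union>F = X"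
    and G: "finite G" "\<forall>C\<in>G. polytope C" "\<Union>G = Y"
    using assms unfolding compact_polyhedron_def by auto
  have "compact_polyhedron (\<Union>z\<in>F\<times>G. fst z \<inter> snd z)"
    using F G by (intro compact_polyhedron_UN compact_polyhedron_polytope) (auto intro: polytope_Int)
  moreover have "(\<Union>z\<in>F\<times>G. fst z \<inter> snd z) = X \<inter> Y" using F G by auto
  ultimately show ?thesis by simp
qed

lemma pl_on_compact_polyhedron: "pl_on X f \<Longrightarrow> compact_polyhedron X"
  unfolding pl_on_def compact_polyhedron_def by blast

lemma pl_onE:
  assumes "pl_on X f"
  obtains F where "finite F" "\<forall>C\<in>F. polytope C" "\<Union>F = X" "\<forall>C\<in>F. affine_map_on C f"
  using assms unfolding pl_on_def by metis

lemma pl_onI: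
  assumes "finite I" "\<And>i. i \<in> I \<Longrightarrow> polytope (C i)" "(\<Union>i\<in>I. C i) = X"
    "\<And>i. i \<in> I \<Longrightarrow> affine_map_on (C i) f"
  shows "pl_on X f"
  unfolding pl_on_def using assms by (intro exI[of _ "C ` I"]) auto

lemma pl_on_affine:
  assumes "compact_polyhedron X" "affine_map_on X f"
  shows "pl_on X f"
  using assms unfolding compact_polyhedron_def pl_on_def by (metis Union_upper affine_map_on_subset)

lemma affine_map_on_ident: "affine_map_on X (\<lambda>x. x)"
  by (rule affine_map_onI[OF linear_ident, of _ _ 0]) simp

lemma pl_on_ident: "compact_polyhedron X \<Longrightarrow> pl_on X (\<lambda>x. x)"
  by (simp add: affine_map_on_ident pl_on_affine)

text \<open>A cell of \<open>f\<close> is subdivided by the preimages of the cells of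
  \<open>g\<close>; each resulting piece is again a polytope by
  \<open>polytope_affine_vimage\<close>.\<close>

lemma pl_on_compose:
  assumes "pl_on X f" "pl_on Y g" "f ` X \<subseteq> Y"
  shows "pl_on X (\<lambda>x. g (f x))"
proof -
  obtain F where F: "finite F" "\<forall>C\<in>F. polytope C" "\<Union>F = X"
      "\<forall>C\<in>F. affine_map_on C f"
    using assms(1) by (rule pl_onE)
  obtain G where G: "finite G" "\<forall>C\<in>G. polytope C" "\<Union>G = Y"
      "\<forall>C\<in>G. affine_map_on C g"
    using assms(2) by (rule pl_onE)
  show ?thesis
  proof (rule pl_onI[of "F \<times> G" "\<lambda>z. {x \<in> fst z. f x \<in> snd z}"])
    show "(\<Union>i\<in>F \<times> G. {x \<in> fst i. f x \<in> snd i}) = X"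
      unfolding F(3)[symmetric] using G(3) assms(3) F(3) by (auto simp: image_subset_iff)
    fix i assume "i \<in> F \<times> G"
    then have *: "affine_map_on (fst i) f" "affine_map_on (snd i) g" using F G by auto
    have "affine_map_on {x \<in> fst i. f x \<in> snd i} f" by (rule affine_map_on_subset[OF *(1)]) auto
    then show "affine_map_on {x \<in> fst i. f x \<in> snd i} (\<lambda>x. g (f x))"
      by (rule affine_map_on_compose[OF _ *(2)]) auto
  qed (use F G in \<open>auto intro: polytope_affine_vimage\<close>)
qed

lemma pl_on_subset:
  assumes "pl_on X f" "compact_polyhedron Y" "Y \<subseteq> X"
  shows "pl_on Y f"
  using pl_on_compose[OF pl_on_ident[OF assms(2)] assms(1)] assms(3) by simp

lemma pl_on_image:
  assumes "pl_on X f"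
  shows "compact_polyhedron (f ` X)"
proof -
  obtain F where F: "finite F" "\<forall>C\<in>F. polytope C" "\<Union>F = X"
      "\<forall>C\<in>F. affine_map_on C f"
    using assms(1) by (rule pl_onE)
  have "compact_polyhedron (\<Union>C\<in>F. f ` C)"
    using F by (intro compact_polyhedron_UN compact_polyhedron_polytope polytope_affine_image) auto
  then show ?thesis unfolding F(3)[symmetric] by (simp only: image_Union)
qed

lemma pl_on_image_subset:
  "pl_on X f \<Longrightarrow> compact_polyhedron Y \<Longrightarrow> Y \<subseteq> X \<Longrightarrow> compact_polyhedron (f ` Y)"
  by (meson pl_on_image pl_on_subset)

lemma pl_on_vimage:
  assumes "pl_on X f" "compact_polyhedron Y"
  shows "compact_polyhedron {x \<in> X. f x \<in> Y}"
proof -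
  obtain F where F: "finite F" "\<forall>C\<in>F. polytope C" "\<Union>F = X"
      "\<forall>C\<in>F. affine_map_on C f"
    using assms(1) by (rule pl_onE)
  obtain G where G: "finite G" "\<forall>C\<in>G. polytope C" "\<Union>G = Y"
    using assms(2) unfolding compact_polyhedron_def by auto
  have "compact_polyhedron (\<Union>z\<in>F\<times>G. {x \<in> fst z. f x \<in> snd z})"
    using F G by (intro compact_polyhedron_UN compact_polyhedron_polytope polytope_affine_vimage) auto
  moreover have "(\<Union>z\<in>F\<times>G. {x \<in> fst z. f x \<in> snd z}) = {x \<in> X. f x \<in> Y}"
    using F(3) G(3) by fastforce
  ultimately show ?thesis by simp
qed

lemma pl_on_continuous: "pl_on X f \<Longrightarrow> continuous_on X f"
proof -
  assume "pl_on X f"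
  then obtain F where F: "finite F" "\<forall>C\<in>F. polytope C" "\<Union>F = X"
      "\<forall>C\<in>F. affine_map_on C f"
    by (rule pl_onE)
  have "continuous_on (\<Union>C\<in>F. C) f"
    using F(1,2,4) by (intro continuous_on_closed_Union)
      (auto intro: continuous_on_affine_map polytope_imp_compact compact_imp_closed)
  then show ?thesis using F(3) by simp
qed

text \<open>The images of the cells of \<open>f\<close> serve as cells for \<open>g\<close>.
  Consequently an injective PL map is already a PL homeomorphism onto its image, and later proofs
  only track one direction.\<close>

lemma pl_on_inverse:
  assumes "pl_on X f" "inj_on f X" "\<And>x. x \<in> X \<Longrightarrow> g (f x) = x"
  shows "pl_on (f ` X) g"
proof -
  obtain F where F: "finite F" "\<forall>C\<in>F. polytope C" "\<Union>F = X"
      "\<forall>C\<in>F. affine_map_on C f"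
    using assms(1) by (rule pl_onE)
  show ?thesis
  proof (rule pl_onI[of F "\<lambda>C. f ` C"])
    fix C assume C: "C \<in> F"
    then have "C \<subseteq> X" using F(3) by blast
    with C show "affine_map_on (f ` C) g"
      using F assms(2) by (intro affine_map_on_inverse polytope_imp_convex) (auto dest: inj_on_subset intro!: assms(3))
  qed (use F in \<open>auto intro: polytope_affine_image\<close>)
qed

lemma pl_homeomorphismI:
  assumes "pl_on X f" "inj_on f X" "f ` X = Y"
  shows "pl_homeomorphism X Y f (inv_into X f)"
proof -
  have "pl_on Y (inv_into X f)"
    using pl_on_inverse[OF assms(1,2), of "inv_into X f"] assms(2,3) by simp
  with assms show ?thesis
    unfolding pl_homeomorphism_def homeomorphism_def by (auto simp: pl_on_continuous)
qed

lemma pl_homeomorphismD: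
  assumes "pl_homeomorphism X Y f g"
  shows "pl_on X f" "pl_on Y g" "f ` X = Y" "g ` Y = X" "inj_on f X" "inj_on g Y"
    "\<And>x. x \<in> X \<Longrightarrow> g (f x) = x" "\<And>y. y \<in> Y \<Longrightarrow> f (g y) = y"
  using assms unfolding pl_homeomorphism_def homeomorphism_def
  by (auto intro: inj_on_inverseI[of X g f] inj_on_inverseI[of "f ` X" f g])

lemma pl_homeomorphicI:
  "pl_on X f \<Longrightarrow> inj_on f X \<Longrightarrow> f ` X = Y \<Longrightarrow> pl_homeomorphic X Y"
  unfolding pl_homeomorphic_def using pl_homeomorphismI by blast

lemma pl_homeomorphicE:
  assumes "pl_homeomorphic X Y"
  obtains f where "pl_on X f" "inj_on f X" "f ` X = Y"
  using assms unfolding pl_homeomorphic_def using pl_homeomorphismD by metis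

lemma pl_homeomorphic_pairI:
  "pl_on X f \<Longrightarrow> inj_on f X \<Longrightarrow> f ` X = Y \<Longrightarrow> f ` A = B \<Longrightarrow> pl_homeomorphic_pair X A Y B"
  unfolding pl_homeomorphic_pair_def using pl_homeomorphismI by blast

lemma pl_homeomorphic_pairE:
  assumes "pl_homeomorphic_pair X A Y B"
  obtains f where "pl_on X f" "inj_on f X" "f ` X = Y" "f ` A = B"
  using assms unfolding pl_homeomorphic_pair_def
  by (elim exE conjE) (rule that, auto dest: pl_homeomorphismD)

lemma pl_homeomorphic_sym: "pl_homeomorphic X Y \<Longrightarrow> pl_homeomorphic Y X"
  unfolding pl_homeomorphic_def pl_homeomorphism_def using homeomorphism_symD by blast

lemma pl_homeomorphic_trans:
  assumes "pl_homeomorphic X Y" "pl_homeomorphic Y Z"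
  shows "pl_homeomorphic X Z"
proof -
  obtain f where f: "pl_on X f" "inj_on f X" "f ` X = Y" using assms(1) by (rule pl_homeomorphicE)
  obtain g where g: "pl_on Y g" "inj_on g Y" "g ` Y = Z" using assms(2) by (rule pl_homeomorphicE)
  show ?thesis
  proof (rule pl_homeomorphicI)
    show "pl_on X (\<lambda>x. g (f x))" using f g pl_on_compose by blast
    show "inj_on (\<lambda>x. g (f x)) X" using comp_inj_on[of f X g] f g by (simp add: comp_def)
    show "(\<lambda>x. g (f x)) ` X = Z" using f g by (simp flip: image_image)
  qed
qed

lemma pl_homeomorphic_pair_sym:
  assumes "pl_homeomorphic_pair X A Y B" "A \<subseteq> X"
  shows "pl_homeomorphic_pair Y B X A"
proof -
  obtain f g where fg: "pl_homeomorphism X Y f g" "f ` A = B"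
    using assms unfolding pl_homeomorphic_pair_def by blast
  have "g ` B = (\<lambda>x. g (f x)) ` A" using fg(2) by (simp flip: fg(2) add: image_image)
  also have "\<dots> = (\<lambda>x. x) ` A"
    using pl_homeomorphismD(7)[OF fg(1)] assms(2) by (intro image_cong) auto
  finally have "g ` B = A" by simp
  then show ?thesis using pl_homeomorphismD[OF fg(1)] by (intro pl_homeomorphic_pairI[of Y g])
qed

lemma pl_homeomorphic_pair_trans:
  assumes "pl_homeomorphic_pair X A Y B" "pl_homeomorphic_pair Y B Z C"
  shows "pl_homeomorphic_pair X A Z C"
proof -
  obtain f where f: "pl_on X f" "inj_on f X" "f ` X = Y" "f ` A = B"
    using assms(1) by (rule pl_homeomorphic_pairE)
  obtain g where g: "pl_on Y g" "inj_on g Y" "g ` Y = Z" "g ` B = C"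
    using assms(2) by (rule pl_homeomorphic_pairE)
  show ?thesis
  proof (rule pl_homeomorphic_pairI)
    show "pl_on X (\<lambda>x. g (f x))" using f g pl_on_compose by blast
    show "inj_on (\<lambda>x. g (f x)) X" using comp_inj_on[of f X g] f g by (simp add: comp_def)
    show "(\<lambda>x. g (f x)) ` X = Z" "(\<lambda>x. g (f x)) ` A = C" using f g by (simp_all flip: image_image)
  qed
qed

section \<open>Dimension\<close>

text \<open>If every intersection had smaller dimension, removing the members of \<open>F\<close>
  one by one from the relative interior of \<open>C\<close> would always leave a nonempty relatively
  open set, although \<open>F\<close> covers \<open>C\<close>. This compares the dimension of a
  polytope in a union of cells with that of a single cell.\<close>

lemma polytope_subset_UN_full_dim:
  fixes C :: "'a::euclidean_space set"
  assumes "convex C" "C \<noteq> {}" "finite F" "\<forall>D\<in>F. closed D" "C \<subseteq> \<Union>F"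
  shows "\<exists>D\<in>F. aff_dim (C \<inter> D) = aff_dim C"
proof (rule ccontr)
  assume "\<not> ?thesis"
  then have less: "aff_dim (C \<inter> D) < aff_dim C" if "D \<in> F" for D
    using that aff_dim_subset[of "C \<inter> D" C] by force
  have "openin (top_of_set (affine hull C)) (rel_interior C - \<Union>G) \<and> rel_interior C - \<Union>G \<noteq> {}"
    if "finite G" "G \<subseteq> F" for G
    using that
  proof (induction G)
    case empty
    then show ?case using assms(1,2) by (simp add: openin_rel_interior rel_interior_eq_empty)
  next
    case (insert D G)
    let ?U = "rel_interior C - \<Union>G"
    have U: "openin (top_of_set (affine hull C)) ?U" "?U \<noteq> {}" using insert by auto
    have eq: "rel_interior C - \<Union>(insert D G) = ?U - D" by auto
    have hull: "aff_dim ?U = aff_dim C"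
      using aff_dim_openin[OF U(1) affine_affine_hull U(2)] by simp
    have "affine hull ?U = affine hull C"
      using affine_hull_openin[OF _ U(2), of "affine hull C"] U(1) by (simp add: hull_hull)
    \<comment> \<open>\<open>?U\<close> spans the same affine hull as \<open>C\<close>, so removing
      a set of smaller dimension from it leaves a dense subset.\<close>
    then have "closure (?U - C \<inter> D) = closure ?U"
      using U(1) less[of D] insert hull by (intro dense_complement_openin_affine_hull) auto
    then have "?U - C \<inter> D \<noteq> {}" using U(2) closure_eq_empty by metis
    moreover have "?U - C \<inter> D = ?U - D" using rel_interior_subset by blast
    moreover have "openin (top_of_set (affine hull C)) (?U - D)"
    proof -
      have "openin (top_of_set (affine hull C)) (?U \<inter> - D)"
        using U(1) assms(4) insert by (intro openin_Int_open) auto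
      then show ?thesis by (simp add: Diff_eq)
    qed
    ultimately show ?case unfolding eq by simp
  qed
  from this[OF assms(3) order_refl] show False
    using assms(5) rel_interior_subset by blast
qed

lemma polyhedron_dim_finite: "finite (aff_dim ` {C. polytope C \<and> C \<subseteq> (X :: 'a::euclidean_space set)})"
proof (rule finite_subset)
  show "aff_dim ` {C. polytope C \<and> C \<subseteq> X} \<subseteq> {-1..int DIM('a)}"
    by (auto simp: aff_dim_geq aff_dim_le_DIM)
qed simp

lemma polyhedron_dim_ge: "polytope C \<Longrightarrow> C \<subseteq> X \<Longrightarrow> aff_dim C \<le> polyhedron_dim X"
  unfolding polyhedron_dim_def by (intro Max_ge polyhedron_dim_finite) auto

lemma polyhedron_dim_attained:
  obtains C where "polytope C" "C \<subseteq> X" "aff_dim C = polyhedron_dim X"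
proof -
  have "polyhedron_dim X \<in> aff_dim ` {C. polytope C \<and> C \<subseteq> X}"
    unfolding polyhedron_dim_def by (intro Max_in polyhedron_dim_finite) (auto intro!: exI[of _ "{}"] polytope_empty)
  then show ?thesis using that by auto
qed

lemma polyhedron_dim_polytope:
  assumes "polytope C" shows "polyhedron_dim C = aff_dim C"
proof -
  obtain D where "polytope D" "D \<subseteq> C" "aff_dim D = polyhedron_dim C" by (rule polyhedron_dim_attained)
  then show ?thesis using aff_dim_subset[of D C] polyhedron_dim_ge[OF assms order_refl] by simp
qed

lemma polyhedron_dim_le_DIM: "polyhedron_dim (X :: 'a::euclidean_space set) \<le> int DIM('a)"
  using polyhedron_dim_attained[of X] aff_dim_le_DIM by metis

text \<open>Two points with the same image would make \<open>f\<close> constant on the segment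
  between them, contradicting injectivity near one endpoint.\<close>

lemma affine_locally_inj:
  assumes "convex C" "affine_map_on C f"
    and loc: "\<And>x. x \<in> C \<Longrightarrow> \<exists>U. open U \<and> x \<in> U \<and> inj_on f (C \<inter> U)"
  shows "inj_on f C"
proof (rule inj_onI, rule ccontr)
  fix x y assume xy: "x \<in> C" "y \<in> C" "f x = f y" "x \<noteq> y"
  obtain U where U: "open U" "x \<in> U" "inj_on f (C \<inter> U)" using loc xy by blast
  obtain e where e: "e > 0" "ball x e \<subseteq> U" using U openE by blast
  \<comment> \<open>The bound 1 keeps \<open>?z\<close> on the segment, hence in \<open>C\<close>;
    the other bound places it within \<open>e / 2\<close> of \<open>x\<close>, hence in
    \<open>U\<close>.\<close>
  define t where "t = min 1 (e / (2 * dist x y))"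
  have t: "0 < t" "t \<le> 1" unfolding t_def using e xy by auto
  let ?z = "x + t *\<^sub>R (y - x)"
  have z: "?z \<in> C"
    using convexD_alt[OF assms(1) xy(1,2), of t] t by (simp add: algebra_simps)
  have "dist x ?z = t * dist x y" using t by (simp add: dist_norm norm_minus_commute)
  also have "\<dots> \<le> e / (2 * dist x y) * dist x y" unfolding t_def by (intro mult_right_mono) auto
  also have "\<dots> < e" using e xy by simp
  finally have "?z \<in> U" using e by auto
  moreover have "f ?z = f x"
    using affine_map_on_convex_combination[OF assms(2) xy(1,2) z] xy by simp
  ultimately have "?z = x" using U z xy by (meson IntI inj_onD)
  then show False using t xy by simp
qed

text \<open>Local injectivity is the right hypothesis because a covering is usually not injective on
  a preimage. On a convex subset of a cell it upgrades to injectivity, so \<open>f\<close> preserves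
  the dimension there; each inequality then follows by finding a full-dimensional part of a maximal
  polytope inside one cell, or inside the image of one cell.\<close>

lemma polyhedron_dim_pl_image:
  assumes "pl_on X f" and loc: "\<And>x. x \<in> X \<Longrightarrow> \<exists>U. open U \<and> x \<in> U \<and> inj_on f (X \<inter> U)"
  shows "polyhedron_dim (f ` X) = polyhedron_dim X"
proof -
  obtain F where F: "finite F" "\<forall>C\<in>F. polytope C" "\<Union>F = X" "\<forall>C\<in>F. affine_map_on C f"
    using assms(1) by (rule pl_onE)
  have inj: "inj_on f C" if "convex C" "C \<subseteq> D" "D \<in> F" for C D
  proof (rule affine_locally_inj[OF that(1)])
    show "affine_map_on C f" using F(4) that(2,3) by (metis affine_map_on_subset)
    have CX: "C \<subseteq> X" using F(3) that(2,3) by blast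
    fix x assume "x \<in> C"
    then obtain U where U: "open U" "x \<in> U" "inj_on f (X \<inter> U)" using loc[of x] CX by blast
    moreover have "inj_on f (C \<inter> U)" using U(3) CX by (meson Int_mono inj_on_subset order_refl)
    ultimately show "\<exists>U. open U \<and> x \<in> U \<and> inj_on f (C \<inter> U)" by blast
  qed
  have dim: "aff_dim (f ` C) = aff_dim C" if "convex C" "C \<subseteq> D" "D \<in> F" for C D
    using aff_dim_affine_image[OF _ that(1) inj[OF that]] that(2,3) F(4) affine_map_on_subset
    by blast
  show ?thesis
  proof (rule antisym)
    obtain C where C: "polytope C" "C \<subseteq> f ` X" "aff_dim C = polyhedron_dim (f ` X)"
      by (rule polyhedron_dim_attained)
    show "polyhedron_dim (f ` X) \<le> polyhedron_dim X"
    proof (cases "C = {}")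
      case True
      then show ?thesis using C(3) polyhedron_dim_ge[OF polytope_empty, of X] by simp
    next
      case False
      have sub: "C \<subseteq> \<Union>((`) f ` F)" using C(2) F(3) by blast
      have "\<forall>D\<in>(`) f ` F. closed D"
        using F(2,4) polytope_affine_image polytope_imp_closed by blast
      from polytope_subset_UN_full_dim[OF polytope_imp_convex[OF C(1)] False _ this sub] F(1)
      obtain D where D: "D \<in> F" "aff_dim (C \<inter> f ` D) = aff_dim C" by auto
      have "aff_dim C \<le> aff_dim (f ` D)" using D(2) aff_dim_subset by (metis inf_le2)
      also have "\<dots> = aff_dim D" using dim[of D D] D F polytope_imp_convex by blast
      also have "\<dots> \<le> polyhedron_dim X" using polyhedron_dim_ge D F by blast
      finally show ?thesis using C by simp
    qed
  next
    obtain C where C: "polytope C" "C \<subseteq> X" "aff_dim C = polyhedron_dim X"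
      by (rule polyhedron_dim_attained)
    show "polyhedron_dim X \<le> polyhedron_dim (f ` X)"
    proof (cases "C = {}")
      case True
      then show ?thesis using C(3) polyhedron_dim_ge[OF polytope_empty, of "f ` X"] by simp
    next
      case False
      then obtain D where D: "D \<in> F" "aff_dim (C \<inter> D) = aff_dim C"
        using polytope_subset_UN_full_dim[of C F] C F
        by (auto simp: polytope_imp_convex polytope_imp_closed)
      have CD: "polytope (C \<inter> D)" using C D F polytope_Int by blast
      have "aff_dim (f ` (C \<inter> D)) = aff_dim C"
        using dim[of "C \<inter> D" D] D CD polytope_imp_convex by auto
      moreover have "polytope (f ` (C \<inter> D))"
        using CD D F affine_map_on_subset polytope_affine_image by (metis inf_le2)
      ultimately show ?thesis
        using C polyhedron_dim_ge[of "f ` (C \<inter> D)" "f ` X"] by (metis image_mono le_infI1)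
    qed
  qed
qed

lemma polyhedron_dim_homeomorphic:
  assumes "pl_homeomorphic X Y" shows "polyhedron_dim X = polyhedron_dim Y"
proof -
  obtain f where f: "pl_on X f" "inj_on f X" "f ` X = Y" using assms by (rule pl_homeomorphicE)
  have "polyhedron_dim (f ` X) = polyhedron_dim X"
    using f by (intro polyhedron_dim_pl_image) (auto intro!: exI[of _ UNIV])
  then show ?thesis using f by simp
qed

section \<open>Simplices and balls\<close>

lemma simplex_exists:
  assumes "n \<le> DIM('a)"
  shows "\<exists>\<Delta> :: 'a::euclidean_space set. int n simplex \<Delta>"
proof -
  obtain B :: "'a set" where B: "\<not> affine_dependent B" "int (card B) = int DIM('a) + 1"
    using aff_dim_basis_exists[of "UNIV :: 'a set"] by auto
  then obtain C where C: "C \<subseteq> B" "card C = n + 1"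
    using assms obtain_subset_with_card_n[of "n + 1" B] by auto
  then have "\<not> affine_dependent C" using B affine_independent_subset by blast
  with C show ?thesis by (intro exI[of _ "convex hull C"] simplex_convex_hull) auto
qed

lemma affine_map_on_convex_hull:
  assumes "linear h"
  shows "(\<lambda>x. h x + b) ` (convex hull S) = convex hull ((\<lambda>x. h x + b) ` S)"
proof -
  have "(\<lambda>x. h x + b) ` T = (+) b ` (h ` T)" for T by (auto simp: image_iff add.commute)
  then show ?thesis using assms by (simp add: convex_hull_linear_image convex_hull_translation)
qed

text \<open>Differences with a fixed point \<open>a\<close> of \<open>C\<close> are linearly
  independent, so their images may be prescribed by a linear map; \<open>b\<close> then corrects the
  value at \<open>a\<close>.\<close>

lemma affine_extension:
  assumes "\<not> affine_dependent (C :: 'a::euclidean_space set)"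
  obtains h and b :: "'b::euclidean_space" where "linear h" "\<And>x. x \<in> C \<Longrightarrow> h x + b = \<phi> x"
proof (cases "C = {}")
  case True
  then show ?thesis using that[of "\<lambda>_. 0" 0] by (simp add: linear_zero)
next
  case False
  then obtain a where a: "a \<in> C" by blast
  then have "independent ((\<lambda>x. -a + x) ` (C - {a}))"
    using assms affine_dependent_iff_dependent2 by blast
  then obtain h where h: "linear h"
      "\<And>v. v \<in> (\<lambda>x. -a + x) ` (C - {a}) \<Longrightarrow> h v = \<phi> (a + v) - \<phi> a"
    using linear_independent_extend[of "(\<lambda>x. -a + x) ` (C - {a})" "\<lambda>v. \<phi> (a + v) - \<phi> a"] by blast
  show ?thesis
  proof (rule that[OF h(1), of "\<phi> a - h a"])
    fix x assume "x \<in> C"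
    then show "h x + (\<phi> a - h a) = \<phi> x"
      using h(2)[of "- a + x"] h(1) by (cases "x = a") (auto simp: linear_diff algebra_simps)
  qed
qed

lemma simplex_affine_iso:
  fixes \<Delta> :: "'a::euclidean_space set" and \<Delta>' :: "'b::euclidean_space set"
  assumes "k simplex \<Delta>" "k simplex \<Delta>'"
  obtains f where "affine_map_on \<Delta> f" "inj_on f \<Delta>" "f ` \<Delta> = \<Delta>'"
proof -
  obtain C where C: "\<not> affine_dependent C" "int (card C) = k + 1" "\<Delta> = convex hull C" "finite C"
    using assms(1) unfolding simplex by (auto simp: aff_independent_finite)
  obtain C' where C': "\<not> affine_dependent C'" "int (card C') = k + 1" "\<Delta>' = convex hull C'" "finite C'"
    using assms(2) unfolding simplex by (auto simp: aff_independent_finite)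
  obtain \<phi> where \<phi>: "bij_betw \<phi> C C'"
    using C C' finite_same_card_bij[of C C'] by auto
  obtain h and b :: 'b where h: "linear h" "\<And>x. x \<in> C \<Longrightarrow> h x + b = \<phi> x"
    using affine_extension[OF C(1), of \<phi>] by metis
  obtain k and c :: 'a where k: "linear k" "\<And>x. x \<in> C' \<Longrightarrow> k x + c = inv_into C \<phi> x"
    using affine_extension[OF C'(1), of "inv_into C \<phi>"] by metis
  have im: "(\<lambda>x. h x + b) ` C = C'" using h \<phi> by (simp add: bij_betw_def)
  have kh: "k (h x + b) + c = x" if "x \<in> convex hull C" for x
  proof -
    \<comment> \<open>\<open>g\<close> is the affine defect of the composite from being the
      identity. It vanishes at the vertices, hence on their convex hull, which makes
      \<open>k y + c\<close> a left inverse.\<close>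
    define g where "g = (\<lambda>x. (k (h x) - x) + (k b + c))"
    have lin: "linear (\<lambda>x. k (h x) - x)"
      using h(1) k(1) by (intro linear_compose_sub linear_compose[of h k, unfolded comp_def] linear_ident)
    have "g y = 0" if "y \<in> C" for y
    proof -
      have "k (h y + b) + c = y"
        using h(2)[OF that] k(2)[of "\<phi> y"] \<phi> that by (auto simp: bij_betw_def)
      then show ?thesis unfolding g_def using k(1) by (simp add: linear_add algebra_simps)
    qed
    then have "g ` C \<subseteq> {0}" by auto
    then have "g ` (convex hull C) \<subseteq> {0}"
      unfolding g_def affine_map_on_convex_hull[OF lin] by (meson convex_singleton hull_minimal)
    then have "g x = 0" using that by blast
    then show ?thesis unfolding g_def using k(1) by (simp add: linear_add algebra_simps)
  qed
  show ?thesis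
  proof (rule that[of "\<lambda>x. h x + b"])
    show "affine_map_on \<Delta> (\<lambda>x. h x + b)" using h by (intro affine_map_onI) auto
    show "inj_on (\<lambda>x. h x + b) \<Delta>" using kh C(3) by (intro inj_on_inverseI[where g="\<lambda>y. k y + c"]) auto
    show "(\<lambda>x. h x + b) ` \<Delta> = \<Delta>'" using affine_map_on_convex_hull[OF h(1)] im C C' by simp
  qed
qed

lemma pl_on_simplex: "k simplex \<Delta> \<Longrightarrow> affine_map_on \<Delta> f \<Longrightarrow> pl_on \<Delta> f"
  by (simp add: compact_polyhedron_polytope pl_on_affine simplex_imp_polytope)

text \<open>\<open>pl_ball\<close> wants its model simplex in the type of the ball, so a new one is
  needed in \<open>'b\<close>. Room for it exists because \<open>B'\<close> has dimension
  \<open>n\<close>, by invariance of \<open>polyhedron_dim\<close>.\<close>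

lemma pl_ball_homeomorphic:
  fixes B :: "'a::euclidean_space set" and B' :: "'b::euclidean_space set"
  assumes "pl_ball n B" "pl_homeomorphic B B'"
  shows "pl_ball n B'"
proof -
  obtain \<Delta> :: "'a set" where D: "int n simplex \<Delta>" "pl_homeomorphic B \<Delta>"
    using assms(1) unfolding pl_ball_def by blast
  have "int n = polyhedron_dim \<Delta>"
    using D(1) by (simp add: polyhedron_dim_polytope aff_dim_simplex simplex_imp_polytope)
  also have "\<dots> = polyhedron_dim B'"
    using D(2) assms(2) by (metis polyhedron_dim_homeomorphic)
  finally have "n \<le> DIM('b)" using polyhedron_dim_le_DIM[of B'] by simp
  then obtain \<Delta>' :: "'b set" where D': "int n simplex \<Delta>'" using simplex_exists by blast
  obtain f where "affine_map_on \<Delta> f" "inj_on f \<Delta>" "f ` \<Delta> = \<Delta>'"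
    using simplex_affine_iso[OF D(1) D'] by blast
  then have "pl_homeomorphic \<Delta> \<Delta>'" using D pl_on_simplex pl_homeomorphicI by blast
  with D(2) have "pl_homeomorphic B \<Delta>'" by (rule pl_homeomorphic_trans)
  with pl_homeomorphic_sym[OF assms(2)] have "pl_homeomorphic B' \<Delta>'" by (rule pl_homeomorphic_trans)
  then show ?thesis unfolding pl_ball_def using D' by blast
qed

lemma pl_ball_le_DIM: "pl_ball n (B :: 'a::euclidean_space set) \<Longrightarrow> n \<le> DIM('a)"
  unfolding pl_ball_def using aff_dim_simplex aff_dim_le_DIM by (metis of_nat_le_iff)

lemma rel_interior_affine_image:
  assumes "affine_map_on C f" "convex C"
  shows "f ` rel_interior C = rel_interior (f ` C)"
proof -
  obtain h b where h: "linear h" "\<And>x. x \<in> C \<Longrightarrow> f x = h x + b"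
      "\<And>D. D \<subseteq> C \<Longrightarrow> f ` D = (+) b ` (h ` D)"
    using affine_map_on_image_translation[OF assms(1)] by metis
  show ?thesis
    using h(3)[of C] h(3)[of "rel_interior C"] rel_interior_subset[of C] assms(2) h(1)
    by (simp add: rel_interior_translation rel_interior_convex_linear_image)
qed

section \<open>Neighbourhoods and interiors\<close>

lemma nbhd_in_iff:
  fixes X :: "'a::metric_space set"
  shows "nbhd_in X x N \<longleftrightarrow> x \<in> N \<and> N \<subseteq> X \<and> (\<exists>e>0. X \<inter> ball x e \<subseteq> N)"
proof
  assume "nbhd_in X x N"
  then obtain U where U: "N \<subseteq> X" "openin (top_of_set X) U" "x \<in> U" "U \<subseteq> N"
    unfolding nbhd_in_def by blast
  then obtain V where V: "open V" "U = X \<inter> V" by (auto simp: openin_open)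
  then obtain e where "e > 0" "ball x e \<subseteq> V" using U(3) openE[of V x] by blast
  then have "X \<inter> ball x e \<subseteq> N" using U V by blast
  then show "x \<in> N \<and> N \<subseteq> X \<and> (\<exists>e>0. X \<inter> ball x e \<subseteq> N)"
    using U \<open>e > 0\<close> by blast
next
  assume "x \<in> N \<and> N \<subseteq> X \<and> (\<exists>e>0. X \<inter> ball x e \<subseteq> N)"
  then show "nbhd_in X x N" unfolding nbhd_in_def
    by (metis IntI centre_in_ball openin_open_Int open_ball subsetD)
qed

lemma nbhd_in_trans:
  fixes X :: "'a::metric_space set"
  assumes "nbhd_in X x N" "nbhd_in N x K"
  shows "nbhd_in X x K"
proof -
  obtain d e where de: "d > 0" "X \<inter> ball x d \<subseteq> N" "e > 0" "N \<inter> ball x e \<subseteq> K"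
    using assms unfolding nbhd_in_iff by blast
  then have "X \<inter> ball x (min d e) \<subseteq> K" by fastforce
  then show ?thesis using assms de unfolding nbhd_in_iff
    by (metis min_less_iff_conj order_trans)
qed

lemma nbhd_in_subset:
  fixes X :: "'a::metric_space set"
  shows "nbhd_in X x K \<Longrightarrow> K \<subseteq> N \<Longrightarrow> N \<subseteq> X \<Longrightarrow> nbhd_in N x K"
  unfolding nbhd_in_iff by blast

lemma nbhd_in_image:
  assumes "homeomorphism N N' f g" "nbhd_in N x K"
  shows "nbhd_in N' (f x) (f ` K)"
proof -
  obtain U where U: "K \<subseteq> N" "openin (top_of_set N) U" "x \<in> U" "U \<subseteq> K"
    using assms unfolding nbhd_in_def by blast
  have "openin (top_of_set N') (f ` U)"
    using homeomorphism_imp_open_map[OF assms(1) U(2)] .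
  then show ?thesis unfolding nbhd_in_def
    using U assms(1) by (intro conjI exI[of _ "f ` U"]) (auto simp: homeomorphism_def)
qed

lemma pl_on_homeomorphism: "pl_on X f \<Longrightarrow> inj_on f X \<Longrightarrow> homeomorphism X (f ` X) f (inv_into X f)"
  using pl_homeomorphismI unfolding pl_homeomorphism_def by blast

lemma pl_interiorI:
  fixes X :: "'a::euclidean_space set"
  assumes "nbhd_in X (\<phi> z) (\<phi> ` \<Delta>)" "int n simplex (\<Delta> :: 'a set)" "pl_on \<Delta> \<phi>" "inj_on \<phi> \<Delta>"
    "z \<in> rel_interior \<Delta>"
  shows "\<phi> z \<in> pl_interior n X"
proof -
  have z: "z \<in> \<Delta>" using assms(5) rel_interior_subset by blast
  let ?g = "inv_into \<Delta> \<phi>"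
  have h: "pl_homeomorphism \<Delta> (\<phi> ` \<Delta>) \<phi> ?g" using assms pl_homeomorphismI by blast
  then have "pl_homeomorphism (\<phi> ` \<Delta>) \<Delta> ?g \<phi>"
    unfolding pl_homeomorphism_def using homeomorphism_symD by blast
  moreover have "?g (\<phi> z) = z" using assms z by simp
  moreover have "\<phi> z \<in> X" using assms(1) unfolding nbhd_in_iff by blast
  ultimately show ?thesis unfolding pl_interior_def using assms by (auto intro!: exI)
qed

lemma pl_interiorE:
  fixes X :: "'a::euclidean_space set"
  assumes "x \<in> pl_interior n X"
  obtains \<phi> and \<Delta> :: "'a set" and z where "x = \<phi> z" "nbhd_in X x (\<phi> ` \<Delta>)" "int n simplex \<Delta>"
    "pl_on \<Delta> \<phi>" "inj_on \<phi> \<Delta>" "z \<in> rel_interior \<Delta>"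
proof -
  obtain N f g and \<Delta> :: "'a set" where *: "nbhd_in X x N" "int n simplex \<Delta>"
      "pl_homeomorphism N \<Delta> f g" "f x \<in> rel_interior \<Delta>"
    using assms unfolding pl_interior_def by blast
  note h = pl_homeomorphismD[OF *(3)]
  have "x \<in> N" using *(1) unfolding nbhd_in_iff by blast
  then show ?thesis using that[of g "f x" \<Delta>] * h by simp
qed

lemma nbhd_in_scaled_simplex:
  fixes \<Delta> :: "'a::euclidean_space set"
  assumes "convex \<Delta>" "z \<in> rel_interior \<Delta>" "0 < e" "e \<le> 1"
  shows "nbhd_in \<Delta> z ((\<lambda>y. z + e *\<^sub>R (y - z)) ` \<Delta>)"
proof -
  obtain r where r: "r > 0" "ball z r \<inter> affine hull \<Delta> \<subseteq> \<Delta>"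
    using assms(2) mem_rel_interior_ball by blast
  have z: "z \<in> \<Delta>" using assms(2) rel_interior_subset by blast
  have "\<Delta> \<inter> ball z (e * r) \<subseteq> (\<lambda>y. z + e *\<^sub>R (y - z)) ` \<Delta>"
  proof
    fix w assume w: "w \<in> \<Delta> \<inter> ball z (e * r)"
    \<comment> \<open>The preimage of \<open>w\<close> under the homothety: it stays in the affine
      hull of \<open>\<Delta>\<close> and has distance less than \<open>r\<close> from
      \<open>z\<close>, where the hull and \<open>\<Delta>\<close> coincide.\<close>
    let ?y = "z + (1/e) *\<^sub>R (w - z)"
    have "?y = (1 - 1/e) *\<^sub>R z + (1/e) *\<^sub>R w" by (simp add: algebra_simps)
    then have "?y \<in> affine hull \<Delta>"
      using w z by (metis IntD1 affine_affine_hull diff_add_cancel hull_inc mem_affine)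
    moreover have "?y \<in> ball z r" using w assms(3)
      by (simp add: dist_norm norm_minus_commute divide_less_eq mult.commute)
    ultimately have "?y \<in> \<Delta>" using r by blast
    moreover have "w = z + e *\<^sub>R (?y - z)" using assms(3) by simp
    ultimately show "w \<in> (\<lambda>y. z + e *\<^sub>R (y - z)) ` \<Delta>" by blast
  qed
  moreover have "(\<lambda>y. z + e *\<^sub>R (y - z)) ` \<Delta> \<subseteq> \<Delta>"
  proof clarify
    fix y assume "y \<in> \<Delta>"
    then show "z + e *\<^sub>R (y - z) \<in> \<Delta>"
      using convexD_alt[OF assms(1) z, of y e] assms by (simp add: algebra_simps)
  qed
  moreover have "z \<in> (\<lambda>y. z + e *\<^sub>R (y - z)) ` \<Delta>" using z by force
  ultimately show ?thesis unfolding nbhd_in_iff using r assms(3) by (metis mult_pos_pos)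
qed

lemma affine_map_on_homothety: "affine_map_on X (\<lambda>y. z + e *\<^sub>R (y - z))"
proof (rule affine_map_onI)
  show "linear (\<lambda>y. e *\<^sub>R y)" by (simp add: linear_scale_self)
  show "z + e *\<^sub>R (y - z) = e *\<^sub>R y + (z - e *\<^sub>R z)" for y by (simp add: algebra_simps)
qed

text \<open>Scaling the chart about the image of \<open>x\<close> makes it fit into the domain of \<open>f\<close>.\<close>

lemma pl_interior_local_image:
  fixes X :: "'a::euclidean_space set" and Y :: "'b::euclidean_space set"
  assumes x: "x \<in> pl_interior n X" and N: "nbhd_in X x N" "nbhd_in Y (f x) (f ` N)"
    and f: "pl_on N f" "inj_on f N"
  shows "f x \<in> pl_interior n Y"
proof -
  obtain \<phi> and \<Delta> :: "'a set" and z where *: "x = \<phi> z" "nbhd_in X x (\<phi> ` \<Delta>)" "int n simplex \<Delta>"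
    "pl_on \<Delta> \<phi>" "inj_on \<phi> \<Delta>" "z \<in> rel_interior \<Delta>"
    using x by (rule pl_interiorE)
  have z: "z \<in> \<Delta>" using * rel_interior_subset by blast
  obtain r where r: "r > 0" "X \<inter> ball x r \<subseteq> N" using N(1) unfolding nbhd_in_iff by blast
  have "continuous_on \<Delta> \<phi>" using * pl_on_continuous by blast
  then obtain d where d: "d > 0" "\<And>y. y \<in> \<Delta> \<Longrightarrow> dist y z < d \<Longrightarrow> dist (\<phi> y) x < r"
    using z r(1) *(1) unfolding continuous_on_iff by metis
  obtain b where b: "b > 0" "\<And>y. y \<in> \<Delta> \<Longrightarrow> norm (y - z) \<le> b"
  proof -
    have "bounded ((\<lambda>y. y - z) ` \<Delta>)"
      using *(3) bounded_translation_minus compact_imp_bounded compact_simplex by blast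
    then show ?thesis using that unfolding bounded_pos by auto
  qed
  \<comment> \<open>As \<open>b\<close> bounds the distance from \<open>z\<close> over
    \<open>\<Delta>\<close>, the scaled simplex lies within \<open>d / 2\<close> of
    \<open>z\<close>, where \<open>\<phi>\<close> stays within \<open>r\<close> of \<open>x\<close>
    and therefore inside \<open>N\<close>.\<close>
  define e where "e = min 1 (d / (2 * b))"
  have e: "0 < e" "e \<le> 1" unfolding e_def using d b by auto
  define s where "s = (\<lambda>y. z + e *\<^sub>R (y - z))"
  have s\<Delta>: "nbhd_in \<Delta> z (s ` \<Delta>)" unfolding s_def
    using *(3,6) e convex_simplex by (intro nbhd_in_scaled_simplex) auto
  have sz: "s z = z" unfolding s_def by simp
  have s: "pl_on \<Delta> s" "inj_on s \<Delta>"
    using *(3) e unfolding s_def by (auto intro!: pl_on_simplex affine_map_on_homothety inj_onI)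
  have s_sub: "s ` \<Delta> \<subseteq> \<Delta>" using s\<Delta> unfolding nbhd_in_iff by blast
  have near: "\<phi> (s y) \<in> N" if "y \<in> \<Delta>" for y
  proof -
    have "dist (s y) z = e * norm (y - z)" unfolding s_def using e by (simp add: dist_norm)
    also have "\<dots> \<le> d / (2 * b) * b"
      using b that e by (intro mult_mono) (auto simp: e_def)
    also have "\<dots> < d" using b d by simp
    finally have "dist (\<phi> (s y)) x < r" using d s_sub that by blast
    moreover have "\<phi> (s y) \<in> X" using *(2) s_sub that unfolding nbhd_in_iff by blast
    ultimately show ?thesis using r by (auto simp: dist_commute)
  qed
  have "nbhd_in (\<phi> ` \<Delta>) x (\<phi> ` s ` \<Delta>)"
    using nbhd_in_image[OF pl_on_homeomorphism s\<Delta>] * by simp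
  then have "nbhd_in X x (\<phi> ` s ` \<Delta>)" using *(2) nbhd_in_trans by blast
  moreover have "\<phi> ` s ` \<Delta> \<subseteq> N" using near by blast
  moreover have "N \<subseteq> X" using N(1) unfolding nbhd_in_iff by blast
  ultimately have "nbhd_in N x (\<phi> ` s ` \<Delta>)" by (rule nbhd_in_subset)
  then have "nbhd_in (f ` N) (f x) (f ` \<phi> ` s ` \<Delta>)"
    using nbhd_in_image pl_on_homeomorphism f by blast
  then have nb: "nbhd_in Y (f x) (f ` \<phi> ` s ` \<Delta>)" using N(2) nbhd_in_trans by blast
  define \<psi> where "\<psi> = (\<lambda>y. f (\<phi> (s y)))"
  have "pl_on \<Delta> (\<lambda>y. \<phi> (s y))" by (rule pl_on_compose[OF s(1) *(4) s_sub])
  then have \<psi>: "pl_on \<Delta> \<psi>" unfolding \<psi>_def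
    by (rule pl_on_compose[OF _ f(1)]) (use near in auto)
  have \<psi>inj: "inj_on \<psi> \<Delta>"
  proof (rule inj_onI)
    fix u v assume uv: "u \<in> \<Delta>" "v \<in> \<Delta>" "\<psi> u = \<psi> v"
    then have "\<phi> (s u) = \<phi> (s v)" using f(2) near unfolding \<psi>_def by (meson inj_onD)
    then have "s u = s v" using *(5) s_sub uv by (meson image_subset_iff inj_onD)
    then show "u = v" using s uv by (meson inj_onD)
  qed
  have "pl_ball n \<Delta>"
    using *(3) pl_on_ident simplex_imp_polytope compact_polyhedron_polytope unfolding pl_ball_def
    by (intro exI[of _ \<Delta>] conjI pl_homeomorphicI[of _ "\<lambda>x. x"]) auto
  then have "pl_ball n (\<psi> ` \<Delta>)" using \<psi> \<psi>inj pl_ball_homeomorphic pl_homeomorphicI by blast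
  then obtain \<Delta>' :: "'b set" where D': "int n simplex \<Delta>'" unfolding pl_ball_def by blast
  obtain \<alpha> where \<alpha>: "affine_map_on \<Delta>' \<alpha>" "inj_on \<alpha> \<Delta>'" "\<alpha> ` \<Delta>' = \<Delta>"
    using simplex_affine_iso[OF D' *(3)] by blast
  have "z \<in> \<alpha> ` rel_interior \<Delta>'"
    unfolding rel_interior_affine_image[OF \<alpha>(1) convex_simplex[OF D']] \<alpha>(3) by (rule *(6))
  then obtain z' where z': "z' \<in> rel_interior \<Delta>'" "\<alpha> z' = z" by blast
  have eq: "\<psi> (\<alpha> z') = f x" using z' sz *(1) by (simp add: \<psi>_def)
  have "\<psi> (\<alpha> z') \<in> pl_interior n Y"
  proof (rule pl_interiorI[where \<phi>="\<lambda>y. \<psi> (\<alpha> y)" and z=z', OF _ D' _ _ z'(1)])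
    have "(\<lambda>y. \<psi> (\<alpha> y)) ` \<Delta>' = \<psi> ` \<Delta>" unfolding \<alpha>(3)[symmetric] image_image ..
    moreover have "\<psi> ` \<Delta> = f ` \<phi> ` s ` \<Delta>" unfolding \<psi>_def image_image ..
    ultimately show "nbhd_in Y (\<psi> (\<alpha> z')) ((\<lambda>y. \<psi> (\<alpha> y)) ` \<Delta>')"
      using nb eq by simp
    show "pl_on \<Delta>' (\<lambda>y. \<psi> (\<alpha> y))"
      using pl_on_compose[OF pl_on_simplex[OF D' \<alpha>(1)] \<psi>] \<alpha> by simp
    show "inj_on (\<lambda>y. \<psi> (\<alpha> y)) \<Delta>'"
      using comp_inj_on[of \<alpha> \<Delta>' \<psi>] \<alpha> \<psi>inj by (simp add: comp_def)
  qed
  then show ?thesis using eq by simp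
qed

lemma nbhd_in_self: "x \<in> X \<Longrightarrow> nbhd_in X x X"
  unfolding nbhd_in_def by auto

lemma pl_interior_subset: "pl_interior n X \<subseteq> X"
  unfolding pl_interior_def by blast

text \<open>The local statement with the whole space as neighbourhood, applied to \<open>f\<close>
  and to its inverse. It is needed for the removed discs and, through boundaries, for the collapsing
  balls.\<close>

lemma pl_interior_image:
  assumes "pl_on X f" "inj_on f X"
  shows "f ` pl_interior n X = pl_interior n (f ` X)"
proof
  show "f ` pl_interior n X \<subseteq> pl_interior n (f ` X)"
  proof clarify
    fix x assume x: "x \<in> pl_interior n X"
    then have "x \<in> X" using pl_interior_subset by blast
    then show "f x \<in> pl_interior n (f ` X)"
      using assms by (intro pl_interior_local_image[OF x, where N=X] nbhd_in_self imageI)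
  qed
  show "pl_interior n (f ` X) \<subseteq> f ` pl_interior n X"
  proof
    fix y assume y: "y \<in> pl_interior n (f ` X)"
    let ?g = "inv_into X f"
    have yX: "y \<in> f ` X" using y pl_interior_subset by blast
    have g: "pl_homeomorphism X (f ` X) f ?g" using assms pl_homeomorphismI by blast
    note g' = pl_homeomorphismD[OF g]
    have "?g y \<in> ?g ` f ` X" using yX by blast
    then have "nbhd_in X (?g y) (?g ` f ` X)" unfolding g'(4) by (rule nbhd_in_self)
    then have "?g y \<in> pl_interior n X"
      by (rule pl_interior_local_image[OF y nbhd_in_self[OF yX] _ g'(2,6)])
    then show "y \<in> f ` pl_interior n X" using yX by (metis f_inv_into_f imageI)
  qed
qed

lemma pl_boundary_image:
  assumes "pl_on X f" "inj_on f X"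
  shows "f ` pl_boundary n X = pl_boundary n (f ` X)"
  unfolding pl_boundary_def pl_interior_image[OF assms, symmetric]
  using assms(2) pl_interior_subset by (intro inj_on_image_set_diff[where C=X]) auto

section \<open>Affine invariance of the local models\<close>

lemma convex_affine_image:
  assumes "affine_map_on C f" "convex C"
  shows "convex (f ` C)"
  using affine_map_on_image_translation[OF assms(1)] assms(2)
  by (metis convex_linear_image convex_translation_eq order_refl)

lemma face_of_affine_image:
  assumes "affine_map_on S f" "convex S" "inj_on f S" "T face_of S"
  shows "f ` T face_of f ` S"
proof -
  have T: "T \<subseteq> S" "convex T"
    "\<And>a b x. a \<in> S \<Longrightarrow> b \<in> S \<Longrightarrow> x \<in> T \<Longrightarrow> x \<in> open_segment a b \<Longrightarrow> a \<in> T \<and> b \<in> T"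
    using assms(4) unfolding face_of_def by auto
  have "f a \<in> f ` T \<and> f b \<in> f ` T"
    if ab: "a \<in> S" "b \<in> S" "x \<in> T" "f x \<in> open_segment (f a) (f b)" for a b x
  proof -
    obtain t where t: "f a \<noteq> f b" "0 < t" "t < 1" "f x = (1 - t) *\<^sub>R f a + t *\<^sub>R f b"
      using ab(4) unfolding in_segment by auto
    \<comment> \<open>The point dividing \<open>a\<close> and \<open>b\<close> in the same ratio has
      the same image as \<open>x\<close>, so injectivity identifies the two and the face property of
      \<open>T\<close> applies.\<close>
    let ?y = "a + t *\<^sub>R (b - a)"
    have y: "?y \<in> S" "?y = (1 - t) *\<^sub>R a + t *\<^sub>R b"
      using convexD_alt[OF assms(2) ab(1,2), of t] t by (simp_all add: algebra_simps)
    have "f ?y = f a + t *\<^sub>R (f b - f a)"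
      using assms(1) ab(1,2) y(1) by (rule affine_map_on_convex_combination)
    also have "\<dots> = f x" unfolding t(4) by (simp add: algebra_simps)
    finally have "f ?y = f x" .
    then have "?y = x" using y(1) T(1) ab(3) assms(3) by (meson inj_onD subsetD)
    then have "x \<in> open_segment a b" unfolding in_segment using t y(2) by auto
    then show ?thesis using T(3) ab by blast
  qed
  moreover have "convex (f ` T)" using T assms(1) affine_map_on_subset convex_affine_image by blast
  ultimately show ?thesis unfolding face_of_def using T(1) by (auto 4 3)
qed

lemma faces_affine_image:
  assumes "affine_map_on S f" "convex S" "inj_on f S"
  shows "{G. G face_of f ` S} = (`) f ` {T. T face_of S}"
proof
  show "(`) f ` {T. T face_of S} \<subseteq> {G. G face_of f ` S}"
    using face_of_affine_image[OF assms] by blast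
  show "{G. G face_of f ` S} \<subseteq> (`) f ` {T. T face_of S}"
  proof
    fix G assume "G \<in> {G. G face_of f ` S}"
    then have G: "G face_of f ` S" by simp
    let ?g = "inv_into S f"
    have "affine_map_on (f ` S) ?g" using assms by (intro affine_map_on_inverse) auto
    from face_of_affine_image[OF this convex_affine_image[OF assms(1,2)] inj_on_inv_into[OF order_refl] G]
    have "?g ` G face_of S" using assms(3) by (simp add: inv_into_image_cancel)
    moreover have "f ` ?g ` G = G" using face_of_imp_subset[OF G] by (intro image_inv_into_cancel) auto
    ultimately show "G \<in> (`) f ` {T. T face_of S}" by (metis image_eqI mem_Collect_eq)
  qed
qed

lemma extreme_points_affine_image:
  assumes "affine_map_on S f" "convex S" "inj_on f S"
  shows "{v. v extreme_point_of f ` S} = f ` {v. v extreme_point_of S}"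
proof -
  have "{v} face_of f ` S \<longleftrightarrow> v \<in> f ` {v. {v} face_of S}" for v
  proof
    assume "{v} face_of f ` S"
    then obtain T where T: "T face_of S" "{v} = f ` T"
      using faces_affine_image[OF assms] by blast
    then obtain w where w: "w \<in> T" "f w = v" by blast
    moreover have "T \<subseteq> {w}"
    proof
      fix u assume "u \<in> T"
      then have "f u = f w" using T(2) w(2) by blast
      then show "u \<in> {w}"
        using \<open>u \<in> T\<close> w(1) face_of_imp_subset[OF T(1)] inj_onD[OF assms(3)] by blast
    qed
    ultimately have "T = {w}" by blast
    then show "v \<in> f ` {v. {v} face_of S}" using T(1) w by blast
  qed (use face_of_affine_image[OF assms] in force)
  then show ?thesis unfolding face_of_singleton by blast
qed

text \<open>Affine maps commute with averages. A global formula \<open>h x + b\<close> is used in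
  place of \<open>affine_map_on\<close> because the sum of the vertices, formed before dividing, may
  leave \<open>\<Delta>\<close>.\<close>

lemma barycenter_affine_image:
  assumes "linear h" "polytope \<Delta>" "\<Delta> \<noteq> {}" "inj_on (\<lambda>x. h x + b) \<Delta>"
  shows "barycenter ((\<lambda>x. h x + b) ` \<Delta>) = h (barycenter \<Delta>) + b"
proof -
  let ?f = "\<lambda>x. h x + b" and ?E = "{v. v extreme_point_of \<Delta>}"
  have conv: "convex \<Delta>" using assms polytope_imp_convex by blast
  have "affine_map_on \<Delta> ?f" using assms(1) by (intro affine_map_onI) auto
  then have E: "{v. v extreme_point_of ?f ` \<Delta>} = ?f ` ?E"
    using conv assms(4) by (rule extreme_points_affine_image)
  have inj: "inj_on ?f ?E" using assms(4) by (rule inj_on_subset) (auto simp: extreme_point_of_def)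
  have fin: "finite ?E" using assms(2) finite_polyhedron_extreme_points polytope_imp_polyhedron by blast
  obtain v where "v extreme_point_of \<Delta>"
    using extreme_point_exists_convex[of \<Delta>] assms polytope_imp_compact conv by blast
  then have pos: "card ?E > 0" using fin by (auto simp: card_gt_0_iff)
  have "(\<Sum>v\<in>?f ` ?E. v) = (\<Sum>v\<in>?E. h v + b)" using inj by (simp add: sum.reindex)
  also have "\<dots> = h (\<Sum>v\<in>?E. v) + real (card ?E) *\<^sub>R b"
    using assms(1) by (simp add: sum.distrib linear_sum sum_constant_scaleR)
  finally show ?thesis
    unfolding barycenter_def E card_image[OF inj] using pos assms(1)
    by (simp add: linear_scale scaleR_add_right)
qed

lemma closed_segment_affine_image:
  assumes "linear h"
  shows "(\<lambda>x. h x + b) ` closed_segment x y = closed_segment (h x + b) (h y + b)"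
proof -
  have "(\<lambda>x. h x + b) ` closed_segment x y = (+) b ` (h ` closed_segment x y)"
    unfolding image_image by (simp add: add.commute)
  then show ?thesis using assms
    by (simp add: closed_segment_linear_image closed_segment_translation add.commute)
qed

lemma pl_cone_image:
  assumes "\<And>y. y \<in> K \<Longrightarrow> f ` closed_segment a y = closed_segment (f a) (f y)"
  shows "f ` pl_cone a K = pl_cone (f a) (f ` K)"
  unfolding pl_cone_def using assms by (auto simp: image_UN)

lemma Pi_model_affine_image:
  assumes "linear h" "polytope \<Delta>" "\<Delta> \<noteq> {}" "inj_on (\<lambda>x. h x + b) \<Delta>"
  shows "Pi_model ((\<lambda>x. h x + b) ` \<Delta>) = (\<lambda>x. h x + b) ` Pi_model \<Delta>"
proof -
  let ?f = "\<lambda>x. h x + b"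
  have conv: "convex \<Delta>" using assms polytope_imp_convex by blast
  have aff: "affine_map_on \<Delta> ?f" using assms(1) by (intro affine_map_onI) auto
  have dim: "aff_dim (?f ` F) = aff_dim F" if "F face_of \<Delta>" for F
    using that aff_dim_affine_image[OF affine_map_on_subset[OF aff] face_of_imp_convex[OF that]]
      face_of_imp_subset[OF that] inj_on_subset[OF assms(4)] by blast
  have "{F. F face_of ?f ` \<Delta> \<and> aff_dim F \<le> d} = {G \<in> {G. G face_of ?f ` \<Delta>}. aff_dim G \<le> d}" for d
    by blast
  also have "\<dots> d = (`) ?f ` {F. F face_of \<Delta> \<and> aff_dim F \<le> d}" for d
    unfolding faces_affine_image[OF aff conv assms(4)] using dim by auto
  finally have faces: "{F. F face_of ?f ` \<Delta> \<and> aff_dim F \<le> d}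
      = (`) ?f ` {F. F face_of \<Delta> \<and> aff_dim F \<le> d}" for d .
  show ?thesis
    unfolding Pi_model_def barycenter_affine_image[OF assms] faces
      aff_dim_affine_image[OF aff conv assms(4)] image_Union[symmetric]
    by (rule pl_cone_image[symmetric]) (rule closed_segment_affine_image[OF assms(1)])
qed

lemma simplex_affine_iso_global:
  fixes \<Delta> :: "'a::euclidean_space set" and \<Delta>' :: "'b::euclidean_space set"
  assumes "k simplex \<Delta>" "k simplex \<Delta>'"
  obtains h b where "linear h" "inj_on (\<lambda>x. h x + b) \<Delta>" "(\<lambda>x. h x + b) ` \<Delta> = \<Delta>'"
proof -
  obtain f where f: "affine_map_on \<Delta> f" "inj_on f \<Delta>" "f ` \<Delta> = \<Delta>'"
    using simplex_affine_iso[OF assms] by blast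
  then obtain h b where h: "linear h" "\<And>x. x \<in> \<Delta> \<Longrightarrow> f x = h x + b"
    unfolding affine_map_on_def by blast
  show ?thesis
  proof (rule that[OF h(1)])
    show "inj_on (\<lambda>x. h x + b) \<Delta>" by (rule iffD1[OF inj_on_cong f(2)]) (rule h(2))
    show "(\<lambda>x. h x + b) ` \<Delta> = \<Delta>'" using f(3) image_cong[OF refl h(2), of \<Delta>] by simp
  qed
qed

lemma rel_frontier_affine_image:
  assumes "affine_map_on C f" "polytope C" "inj_on f C"
  shows "rel_frontier (f ` C) = f ` rel_frontier C"
proof -
  have "closed C" "closed (f ` C)" "convex C"
    using assms polytope_affine_image polytope_imp_closed polytope_imp_convex by blast+
  then have "rel_frontier (f ` C) = f ` C - f ` rel_interior C"
    unfolding rel_frontier_def using assms(1) by (simp add: rel_interior_affine_image)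
  also have "\<dots> = f ` (C - rel_interior C)"
    using assms(3) rel_interior_subset by (intro inj_on_image_set_diff[symmetric, where C=C]) auto
  finally show ?thesis unfolding rel_frontier_def using \<open>closed C\<close> by simp
qed

text \<open>The product \<open>F\<close> of affine isomorphisms of the factors carries faces,
  barycenter and frontier along, so models in different types can be exchanged. The hypothesis
  \<open>cp\<close> turns \<open>F\<close> into a PL map; in the application it comes from a link
  homeomorphic to the model.\<close>

lemma bd_Pi_model_homeomorphic:
  fixes \<Delta> :: "'a::euclidean_space set" and \<Delta>' :: "'c::euclidean_space set"
    and T :: "'b::euclidean_space set" and T' :: "'d::euclidean_space set"
  assumes "j simplex \<Delta>" "j simplex \<Delta>'" "k simplex T" "k simplex T'" "\<Delta> \<noteq> {}"
    and cp: "compact_polyhedron (bd_Pi_model \<Delta> T)"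
  shows "pl_homeomorphic (bd_Pi_model \<Delta> T) (bd_Pi_model \<Delta>' T')"
proof -
  obtain h b where h: "linear h" "inj_on (\<lambda>x. h x + b) \<Delta>" "(\<lambda>x. h x + b) ` \<Delta> = \<Delta>'"
    using simplex_affine_iso_global[OF assms(1,2)] by blast
  obtain g c where g: "linear g" "inj_on (\<lambda>x. g x + c) T" "(\<lambda>x. g x + c) ` T = T'"
    using simplex_affine_iso_global[OF assms(3,4)] by blast
  define F where "F = (\<lambda>z. (h (fst z) + b, g (snd z) + c))"
  have lin: "linear (\<lambda>z. (h (fst z), g (snd z)))"
    using h(1) g(1) by (auto intro!: linearI simp: linear_add linear_scale)
  have aff: "affine_map_on X F" for X
    unfolding F_def by (rule affine_map_onI[OF lin, where b="(b, c)"]) simp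
  have F_Times: "F ` (A \<times> B) = ((\<lambda>x. h x + b) ` A) \<times> ((\<lambda>x. g x + c) ` B)" for A B
    unfolding F_def by force
  have pt: "polytope \<Delta>" "polytope T" using assms simplex_imp_polytope by blast+
  have inj: "inj_on F (\<Delta> \<times> T)"
    using h(2) g(2) unfolding F_def inj_on_def by auto
  have Pi: "Pi_model \<Delta>' = (\<lambda>x. h x + b) ` Pi_model \<Delta>"
    using Pi_model_affine_image[OF h(1) pt(1) assms(5) h(2)] h(3) by simp
  have rf: "rel_frontier (\<Delta>' \<times> T') = F ` rel_frontier (\<Delta> \<times> T)"
    using rel_frontier_affine_image[OF aff polytope_Times[OF pt] inj] F_Times h(3) g(3) by simp
  have sub: "rel_frontier (\<Delta> \<times> T) \<subseteq> \<Delta> \<times> T"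
    using polytope_imp_closed[OF polytope_Times[OF pt]] by (auto simp: rel_frontier_def)
  \<comment> \<open>Both factors of the intersection must lie in \<open>\<Delta> \<times> T\<close>,
    where \<open>F\<close> is injective, for the image to commute with the intersection.\<close>
  have PiD: "Pi_model \<Delta> \<subseteq> \<Delta>"
  proof -
    have "convex \<Delta>" using pt polytope_imp_convex by blast
    moreover have "barycenter \<Delta> \<in> \<Delta>"
    proof -
      let ?E = "{v. v extreme_point_of \<Delta>}"
      have fin: "finite ?E" using pt finite_polyhedron_extreme_points polytope_imp_polyhedron by blast
      obtain v where "v extreme_point_of \<Delta>"
        using extreme_point_exists_convex[of \<Delta>] assms pt polytope_imp_compact calculation by blast
      then have pos: "card ?E > 0" using fin by (auto simp: card_gt_0_iff)
      have "(\<Sum>v\<in>?E. 1 / real (card ?E)) = 1" using pos by simp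
      then have "(\<Sum>v\<in>?E. (1 / real (card ?E)) *\<^sub>R v) \<in> \<Delta>"
        by (intro convex_sum[OF fin calculation]) (auto simp: extreme_point_of_def)
      then show ?thesis by (simp add: barycenter_def scaleR_sum_right divide_inverse)
    qed
    ultimately show ?thesis
      unfolding Pi_model_def pl_cone_def using closed_segment_subset face_of_imp_subset by fastforce
  qed
  show ?thesis
  proof (rule pl_homeomorphicI)
    show "pl_on (bd_Pi_model \<Delta> T) F" using cp aff by (rule pl_on_affine)
    show "inj_on F (bd_Pi_model \<Delta> T)"
      using inj sub by (rule inj_on_subset[OF _ order_trans[rotated]]) (auto simp: bd_Pi_model_def)
    have "Pi_model \<Delta> \<times> T \<subseteq> \<Delta> \<times> T" using PiD by blast
    then have "F ` (Pi_model \<Delta> \<times> T \<inter> rel_frontier (\<Delta> \<times> T))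
        = F ` (Pi_model \<Delta> \<times> T) \<inter> F ` rel_frontier (\<Delta> \<times> T)"
      using inj_on_image_Int[OF inj _ sub] by blast
    then show "F ` bd_Pi_model \<Delta> T = bd_Pi_model \<Delta>' T'"
      unfolding bd_Pi_model_def rf Pi using F_Times g(3) by simp
  qed
qed

section \<open>Suspensions\<close>

text \<open>The slice of a suspension at height \<open>s\<close> is a copy of the base scaled by
  \<open>1 - \<bar>s\<bar>\<close>; the map unscales, applies \<open>f\<close> and scales back. At a
  pole the prefactor is 0, so the value does not depend on \<open>f\<close> or on the division by
  zero.\<close>

definition suspension_map ::
  "('a::real_vector \<Rightarrow> 'b::real_vector) \<Rightarrow> 'a \<times> real \<Rightarrow> 'b \<times> real" where
  "suspension_map f z =
     ((1 - \<bar>snd z\<bar>) *\<^sub>R f (fst z /\<^sub>R (1 - \<bar>snd z\<bar>)), snd z)"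

lemma suspension_map_apply:
  "suspension_map f ((1 - \<bar>s\<bar>) *\<^sub>R y, s) = ((1 - \<bar>s\<bar>) *\<^sub>R f y, s)"
  unfolding suspension_map_def by (cases "\<bar>s\<bar> = 1") auto

lemma suspension_map_pole: "\<bar>s\<bar> = 1 \<Longrightarrow> suspension_map f (0, s) = (0, s)"
  unfolding suspension_map_def by simp

lemma closed_segment_pole:
  "closed_segment (0, \<sigma>) (y, 0) = {(u *\<^sub>R y, (1 - u) * \<sigma>) | u. 0 \<le> u \<and> u \<le> (1::real)}"
  unfolding closed_segment_def by auto

text \<open>Parametrizing by height treats both cones at once. The poles are listed separately
  because the suspension of the empty set still consists of them.\<close>

lemma suspension_eq:
  "suspension Y = {(0, 1), (0, -1)} \<union> {((1 - \<bar>s\<bar>) *\<^sub>R y, s) | y s. y \<in> Y \<and> \<bar>s\<bar> \<le> 1}"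
proof -
  have *: "(\<Union>z\<in>Y \<times> {0}. closed_segment (0, \<sigma>) z)
      = {((1 - \<bar>s\<bar>) *\<^sub>R y, s) | y s. y \<in> Y \<and> \<bar>s\<bar> \<le> 1 \<and> 0 \<le> \<sigma> * s}"
    if "\<sigma> = 1 \<or> \<sigma> = -1" for \<sigma> :: real
  proof (intro set_eqI iffI)
    fix w assume "w \<in> (\<Union>z\<in>Y \<times> {0}. closed_segment (0, \<sigma>) z)"
    then obtain y u where y: "y \<in> Y" "0 \<le> u" "u \<le> 1" "w = (u *\<^sub>R y, (1 - u) * \<sigma>)"
      unfolding mem_Times_iff by (auto simp: closed_segment_pole)
    moreover have "1 - \<bar>(1 - u) * \<sigma>\<bar> = u" "\<bar>(1 - u) * \<sigma>\<bar> \<le> 1" "0 \<le> \<sigma> * ((1 - u) * \<sigma>)"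
      using y that by auto
    ultimately show "w \<in> {((1 - \<bar>s\<bar>) *\<^sub>R y, s) | y s. y \<in> Y \<and> \<bar>s\<bar> \<le> 1 \<and> 0 \<le> \<sigma> * s}"
      by (smt (verit) mem_Collect_eq)
  next
    fix w assume "w \<in> {((1 - \<bar>s\<bar>) *\<^sub>R y, s) | y s. y \<in> Y \<and> \<bar>s\<bar> \<le> 1 \<and> 0 \<le> \<sigma> * s}"
    then obtain y s where y: "y \<in> Y" "\<bar>s\<bar> \<le> 1" "0 \<le> \<sigma> * s" "w = ((1 - \<bar>s\<bar>) *\<^sub>R y, s)" by blast
    have "s = (1 - (1 - \<bar>s\<bar>)) * \<sigma>" using that y(3) by (auto simp: abs_if split: if_splits)
    then have "w \<in> closed_segment (0, \<sigma>) (y, 0)"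
      unfolding closed_segment_pole using y by (auto intro!: exI[of _ "1 - \<bar>s\<bar>"])
    then show "w \<in> (\<Union>z\<in>Y \<times> {0}. closed_segment (0, \<sigma>) z)" using y(1) by blast
  qed
  show ?thesis
    unfolding suspension_def pl_cone_def *[of 1, simplified] *[of "-1", simplified]
    using linorder_linear by blast
qed

lemma suspension_map_image: "suspension_map f ` suspension Y = suspension (f ` Y)"
proof (intro set_eqI iffI)
  fix w assume "w \<in> suspension_map f ` suspension Y"
  then obtain v where v: "v \<in> suspension Y" "w = suspension_map f v" by blast
  from v(1) consider "v = (0, 1)" | "v = (0, -1)"
    | y s where "y \<in> Y" "\<bar>s\<bar> \<le> 1" "v = ((1 - \<bar>s\<bar>) *\<^sub>R y, s)"
    unfolding suspension_eq by blast
  then show "w \<in> suspension (f ` Y)"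
  proof cases
    case 3
    then have "w = ((1 - \<bar>s\<bar>) *\<^sub>R f y, s)" using v(2) by (simp only: suspension_map_apply)
    then show ?thesis unfolding suspension_eq using 3(1,2) by blast
  qed (simp_all add: v(2) suspension_map_pole suspension_eq)
next
  fix w assume "w \<in> suspension (f ` Y)"
  then consider "w = (0, 1)" | "w = (0, -1)"
    | y s where "y \<in> Y" "\<bar>s\<bar> \<le> 1" "w = ((1 - \<bar>s\<bar>) *\<^sub>R f y, s)"
    unfolding suspension_eq by blast
  then show "w \<in> suspension_map f ` suspension Y"
  proof cases
    case 1
    then show ?thesis
      by (intro image_eqI[of _ _ "(0, 1)"]) (auto simp: suspension_map_pole suspension_eq)
  next
    case 2
    then show ?thesis
      by (intro image_eqI[of _ _ "(0, -1)"]) (auto simp: suspension_map_pole suspension_eq)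
  next
    case 3
    then show ?thesis
      by (intro image_eqI[of _ _ "((1 - \<bar>s\<bar>) *\<^sub>R y, s)"]) (auto simp: suspension_map_apply suspension_eq)
  qed
qed

lemma suspension_cases:
  assumes "w \<in> suspension Y"
  obtains s where "\<bar>s\<bar> = 1" "w = (0, s)"
    | y s where "y \<in> Y" "\<bar>s\<bar> < 1" "w = ((1 - \<bar>s\<bar>) *\<^sub>R y, s)"
proof -
  from assms consider "w = (0, 1)" | "w = (0, -1)"
    | y s where "y \<in> Y" "\<bar>s\<bar> \<le> 1" "w = ((1 - \<bar>s\<bar>) *\<^sub>R y, s)"
    unfolding suspension_eq by blast
  then show ?thesis
  proof cases
    case 3
    then show ?thesis using that by (cases "\<bar>s\<bar> = 1") auto
  qed (use that in force)+
qed

lemma inj_on_suspension_map: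
  assumes "inj_on f Y" shows "inj_on (suspension_map f) (suspension Y)"
proof (rule inj_onI)
  fix w w' assume w: "w \<in> suspension Y" "w' \<in> suspension Y" "suspension_map f w = suspension_map f w'"
  then have snd: "snd w = snd w'" by (simp add: suspension_map_def)
  from w(1) show "w = w'"
  proof (cases rule: suspension_cases)
    case (1 s)
    from w(2) show ?thesis by (cases rule: suspension_cases) (use 1 snd in auto)
  next
    case (2 y s)
    from w(2) show ?thesis
    proof (cases rule: suspension_cases)
      case (1 s')
      then show ?thesis using 2 snd by auto
    next
      case (2 y' s')
      have s: "s' = s" using snd \<open>w = _\<close> 2(3) by simp
      have "(1 - \<bar>s\<bar>) *\<^sub>R f y = (1 - \<bar>s\<bar>) *\<^sub>R f y'"
        using w(3) unfolding \<open>w = _\<close> 2(3) s suspension_map_apply by simp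
      then have "f y = f y'" using \<open>\<bar>s\<bar> < 1\<close> by simp
      then have "y = y'" using assms 2(1) \<open>y \<in> Y\<close> by (meson inj_onD)
      then show ?thesis using 2(3) \<open>w = _\<close> s by simp
    qed
  qed
qed

text \<open>The cones from both poles over the cells of \<open>f\<close> are polytopes, and
  \<open>suspension_map f\<close> is affine on each of them.\<close>

lemma pl_on_suspension_map:
  assumes "pl_on Y f"
  shows "pl_on (suspension Y) (suspension_map f)"
proof -
  obtain F where F: "finite F" "\<forall>C\<in>F. polytope C" "\<Union>F = Y" "\<forall>C\<in>F. affine_map_on C f"
    using assms(1) by (rule pl_onE)
  let ?cell = "\<lambda>z. convex hull (insert (0, snd z) (fst z \<times> {0}))"
  have hull: "?cell (C, \<sigma>) = pl_cone (0, \<sigma>) (C \<times> {0})" if "polytope C" for C :: "'a set" and \<sigma> :: real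
  proof (cases "C = {}")
    case True
    then show ?thesis by (simp add: pl_cone_def)
  next
    case False
    have "convex (C \<times> {0::real})" using that polytope_imp_convex by (intro convex_Times) auto
    then have eq: "convex hull (C \<times> {0::real}) = C \<times> {0}" by (rule hull_same)
    show ?thesis
      unfolding pl_cone_def using False
      by (auto simp: convex_hull_insert_segments eq)
  qed
  show ?thesis
  \<comment> \<open>The empty cell contributes the poles themselves as cells, which covers the case
    of an empty \<open>Y\<close>.\<close>
  proof (rule pl_onI[of "insert {} F \<times> {1, -1}" ?cell])
    show "finite (insert {} F \<times> {1, - 1 :: real})" using F by simp
  next
    fix i assume i: "i \<in> insert {} F \<times> {1, - 1 :: real}"
    then have pi: "polytope (fst i)" using F polytope_empty by auto
    then have "polytope (fst i \<times> {0::real})" using polytope_Times polytope_sing by blast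
    then obtain V where V: "finite V" "fst i \<times> {0::real} = convex hull V"
      unfolding polytope_def by blast
    have "?cell i = convex hull (insert (0, snd i) V)" unfolding V(2) by (metis hull_insert)
    then show "polytope (?cell i)" using V(1) by (simp add: polytope_convex_hull)
    obtain h b where h: "linear h" "\<And>x. x \<in> fst i \<Longrightarrow> f x = h x + b"
    proof -
      have "affine_map_on (fst i) f" using i F by (auto intro: affine_map_onI[OF linear_zero])
      then show ?thesis using that unfolding affine_map_on_def by blast
    qed
    obtain \<sigma> where \<sigma>: "i = (fst i, \<sigma>)" "\<sigma> = 1 \<or> \<sigma> = -1" using i by (cases i) auto
    show "affine_map_on (?cell i) (suspension_map f)"
    proof (rule affine_map_onI)
      \<comment> \<open>On a cone point \<open>(u *\<^sub>R y, (1 - u) * \<sigma>)\<close> the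
        required first coordinate is \<open>u *\<^sub>R f y\<close>, that is
        \<open>h (u *\<^sub>R y) + u *\<^sub>R b\<close>. Since
        \<open>\<sigma> * snd z = 1 - u\<close>, the coefficient \<open>u\<close> of
        \<open>b\<close> is an affine function of the height.\<close>
      show "linear (\<lambda>z. (h (fst z) - (\<sigma> * snd z) *\<^sub>R b, snd z))"
        using h(1) by (intro linearI) (auto simp: linear_add linear_scale algebra_simps)
      fix z assume "z \<in> ?cell i"
      then have "z \<in> pl_cone (0, \<sigma>) (fst i \<times> {0})" using hull[OF pi, of \<sigma>] \<sigma>(1) by simp
      then consider "z = (0, \<sigma>)" | y u where "y \<in> fst i" "0 \<le> u" "u \<le> 1" "z = (u *\<^sub>R y, (1 - u) * \<sigma>)"
        unfolding pl_cone_def by (auto simp: closed_segment_pole)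
      then show "suspension_map f z = (h (fst z) - (\<sigma> * snd z) *\<^sub>R b, snd z) + (b, 0)"
      proof cases
        case 1
        then show ?thesis using \<sigma>(2) h(1) by (auto simp: suspension_map_pole linear_0)
      next
        case 2
        have "1 - \<bar>(1 - u) * \<sigma>\<bar> = u" "\<sigma> * ((1 - u) * \<sigma>) = 1 - u" using 2 \<sigma>(2) by auto
        then have "suspension_map f z = (u *\<^sub>R f y, (1 - u) * \<sigma>)"
          using suspension_map_apply[of f "(1 - u) * \<sigma>" y] 2(4) by simp
        moreover have "h (fst z) - (\<sigma> * snd z) *\<^sub>R b + b = u *\<^sub>R f y"
        proof -
          have z: "\<sigma> * snd z = 1 - u" "fst z = u *\<^sub>R y"
            using 2(4) \<open>\<sigma> * ((1 - u) * \<sigma>) = 1 - u\<close> by simp_all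
          show ?thesis unfolding z using h(1) h(2)[OF 2(1)] by (simp add: linear_scale algebra_simps)
        qed
        ultimately show ?thesis using 2(4) by simp
      qed
    qed
  next
    have "(\<Union>i\<in>insert {} F \<times> {1, -1 :: real}. ?cell i)
        = (\<Union>i\<in>insert {} F \<times> {1, -1}. pl_cone (0, snd i) (fst i \<times> {0}))"
    proof (rule SUP_cong[OF refl])
      fix i assume "i \<in> insert {} F \<times> {1, - 1 :: real}"
      then have "polytope (fst i)" using F polytope_empty by auto
      then show "?cell i = pl_cone (0, snd i) (fst i \<times> {0})" using hull[of "fst i" "snd i"] by simp
    qed
    also have "\<dots> = suspension Y"
      unfolding suspension_def pl_cone_def F(3)[symmetric] by auto
    finally show "(\<Union>i\<in>insert {} F \<times> {1, -1 :: real}. ?cell i) = suspension Y" .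
  qed
qed

lemma suspension_pair_homeomorphic:
  assumes "pl_on Y f" "inj_on f Y"
  shows "pl_homeomorphic_pair (suspension Y) (suspension B) (suspension (f ` Y)) (suspension (f ` B))"
  by (rule pl_homeomorphic_pairI[OF pl_on_suspension_map inj_on_suspension_map])
    (use assms suspension_map_image in auto)

lemma suspension_homeomorphic:
  assumes "pl_on Y f" "inj_on f Y"
  shows "pl_homeomorphic (suspension Y) (suspension (f ` Y))"
  by (rule pl_homeomorphicI[OF pl_on_suspension_map inj_on_suspension_map])
    (use assms suspension_map_image in auto)

lemma equator_mem_suspension: "(y, 0) \<in> suspension Y \<longleftrightarrow> y \<in> Y"
  unfolding suspension_eq by auto

lemma equator_pl:
  assumes "compact_polyhedron Y"
  shows "pl_on Y (\<lambda>y. (y, 0::real))"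
proof -
  have "affine_map_on Y (\<lambda>y. (y, 0::real))"
    by (rule affine_map_onI[of "\<lambda>y. (y, 0)" _ _ 0]) (auto intro!: linearI)
  then show ?thesis using assms pl_on_affine by blast
qed

lemma pl_homeomorphic_compact_polyhedron: "pl_homeomorphic X Y \<Longrightarrow> compact_polyhedron X"
  by (meson pl_homeomorphicE pl_on_compact_polyhedron)

lemma is_suspension_compact_polyhedron: "is_suspension t X \<Longrightarrow> compact_polyhedron X"
  by (cases t) (auto dest: pl_homeomorphic_compact_polyhedron)

lemma is_suspension_pair_compact_polyhedron: "is_suspension_pair t X A \<Longrightarrow> compact_polyhedron X"
  by (cases t) (auto elim!: pl_homeomorphic_pairE intro: pl_on_compact_polyhedron)

text \<open>A desuspension is transported as the equator of a suspension structure on the image.\<close>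

lemma is_suspension_homeomorphic:
  fixes X :: "'a::euclidean_space set" and X' :: "'b::euclidean_space set"
  assumes "is_suspension t X" "pl_homeomorphic X X'"
  shows "is_suspension t X'"
  using assms
proof (induction t arbitrary: X X')
  case 0
  then show ?case using pl_homeomorphic_compact_polyhedron pl_homeomorphic_sym by auto
next
  case (Suc t)
  then obtain Y :: "'a set" where Y: "is_suspension t Y" "pl_homeomorphic X (suspension Y)" by auto
  have X'Y: "pl_homeomorphic X' (suspension Y)"
    using pl_homeomorphic_trans[OF pl_homeomorphic_sym[OF Suc.prems(2)] Y(2)] .
  then obtain h where h: "pl_on (suspension Y) h" "inj_on h (suspension Y)" "h ` suspension Y = X'"
    using pl_homeomorphic_sym pl_homeomorphicE by blast
  define \<phi> where "\<phi> = (\<lambda>y. h (y, 0))"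
  have \<phi>: "pl_on Y \<phi>"
    unfolding \<phi>_def using is_suspension_compact_polyhedron[OF Y(1)]
    by (intro pl_on_compose[OF equator_pl h(1)]) (auto simp: equator_mem_suspension)
  have inj: "inj_on \<phi> Y"
    using h(2) unfolding \<phi>_def inj_on_def by (metis equator_mem_suspension prod.inject)
  have "is_suspension t (\<phi> ` Y)" using Suc.IH[OF Y(1)] pl_homeomorphicI[OF \<phi> inj refl] by blast
  moreover have "pl_homeomorphic X' (suspension (\<phi> ` Y))"
    using pl_homeomorphic_trans[OF X'Y suspension_homeomorphic[OF \<phi> inj]] .
  ultimately show ?case by auto
qed

text \<open>The equator argument for pairs: a single \<open>\<phi>\<close> transports
  \<open>Y\<close> and \<open>B\<close> into the type of the image, so the new desuspension remains
  a pair.\<close>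

lemma is_suspension_pair_image:
  fixes X :: "'a::euclidean_space set" and f :: "'a \<Rightarrow> 'b::euclidean_space"
  assumes "is_suspension_pair t X A" "A \<subseteq> X" "pl_on X f" "inj_on f X"
  shows "is_suspension_pair t (f ` X) (f ` A)"
  using assms
proof (induction t arbitrary: X A f)
  case 0
  then show ?case by (auto intro: pl_on_image pl_on_image_subset)
next
  case (Suc t)
  then obtain Y B :: "'a set" where Y: "is_suspension_pair t Y B"
      "pl_homeomorphic_pair X A (suspension Y) (suspension B)" by auto
  \<comment> \<open>The definition states the inclusion only at level 0; for the induction
    hypothesis it is recovered here from the homeomorphism of pairs and the equators.\<close>
  have "suspension B \<subseteq> suspension Y"
    using Y(2) Suc.prems(2) pl_homeomorphic_pairE by (metis image_mono)
  then have B: "B \<subseteq> Y" using equator_mem_suspension by blast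
  have "pl_homeomorphic_pair X A (f ` X) (f ` A)" using Suc.prems pl_homeomorphic_pairI by blast
  then have "pl_homeomorphic_pair (f ` X) (f ` A) X A"
    using Suc.prems(2) by (rule pl_homeomorphic_pair_sym)
  then have X'Y: "pl_homeomorphic_pair (f ` X) (f ` A) (suspension Y) (suspension B)"
    using Y(2) by (rule pl_homeomorphic_pair_trans)
  then obtain h where h: "pl_on (suspension Y) h" "inj_on h (suspension Y)"
      "h ` suspension Y = f ` X" "h ` suspension B = f ` A"
    using pl_homeomorphic_pair_sym[OF X'Y] Suc.prems(2) pl_homeomorphic_pairE by (metis image_mono)
  define \<phi> where "\<phi> = (\<lambda>y. h (y, 0))"
  have \<phi>: "pl_on Y \<phi>"
    unfolding \<phi>_def using is_suspension_pair_compact_polyhedron[OF Y(1)]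
    by (intro pl_on_compose[OF equator_pl h(1)]) (auto simp: equator_mem_suspension)
  have inj: "inj_on \<phi> Y"
    using h(2) unfolding \<phi>_def inj_on_def by (metis equator_mem_suspension prod.inject)
  have "is_suspension_pair t (\<phi> ` Y) (\<phi> ` B)" by (rule Suc.IH[OF Y(1) B \<phi> inj])
  moreover have "pl_homeomorphic_pair (f ` X) (f ` A) (suspension (\<phi> ` Y)) (suspension (\<phi> ` B))"
    using pl_homeomorphic_pair_trans[OF X'Y suspension_pair_homeomorphic[OF \<phi> inj]] .
  ultimately show ?case by auto
qed

lemma is_suspension_image_iff:
  assumes "pl_on X f" "inj_on f X"
  shows "is_suspension t (f ` X) \<longleftrightarrow> is_suspension t X"
  using assms is_suspension_homeomorphic pl_homeomorphicI pl_homeomorphic_sym by metis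

lemma is_suspension_pair_image_iff:
  assumes "pl_on X f" "inj_on f X" "A \<subseteq> X"
  shows "is_suspension_pair t (f ` X) (f ` A) \<longleftrightarrow> is_suspension_pair t X A"
proof
  let ?g = "inv_into X f"
  note g = pl_homeomorphismD[OF pl_homeomorphismI[OF assms(1,2) refl]]
  assume "is_suspension_pair t (f ` X) (f ` A)"
  then have "is_suspension_pair t (?g ` f ` X) (?g ` f ` A)"
    using image_mono[OF assms(3)] g(2,6) by (rule is_suspension_pair_image)
  then show "is_suspension_pair t X A"
    using assms(2,3) by (simp add: inv_into_image_cancel)
qed (use assms is_suspension_pair_image in blast)

section \<open>Links under local PL homeomorphisms\<close>

text \<open>The cells missing \<open>x\<close> form a closed set, so every point near
  \<open>x\<close> shares a cell with \<open>x\<close>; that cell is convex and \<open>f\<close> is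
  affine on it.\<close>

lemma pl_on_conical:
  assumes "pl_on X f" "x \<in> X"
  obtains e where "e > 0"
    "\<And>y t. y \<in> X \<Longrightarrow> dist x y < e \<Longrightarrow> 0 \<le> t \<Longrightarrow> t \<le> 1 \<Longrightarrow>
       x + t *\<^sub>R (y - x) \<in> X \<and> f (x + t *\<^sub>R (y - x)) = f x + t *\<^sub>R (f y - f x)"
proof -
  obtain F where F: "finite F" "\<forall>C\<in>F. polytope C" "\<Union>F = X" "\<forall>C\<in>F. affine_map_on C f"
    using assms(1) by (rule pl_onE)
  have "closed (\<Union>{C \<in> F. x \<notin> C})" using F(1,2) polytope_imp_closed by (intro closed_Union) auto
  then obtain e where e: "e > 0" "\<And>y. y \<in> \<Union>{C \<in> F. x \<notin> C} \<Longrightarrow> e \<le> dist x y"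
    using separate_point_closed[of "\<Union>{C \<in> F. x \<notin> C}" x] by blast
  show ?thesis
  proof (rule that[OF e(1)])
    fix y t assume y: "y \<in> X" "dist x y < e" "0 \<le> t" "t \<le> (1::real)"
    then obtain C where C: "C \<in> F" "y \<in> C" using F(3) by blast
    have xC: "x \<in> C"
    proof (rule ccontr)
      assume "x \<notin> C"
      then have "e \<le> dist x y" using C by (intro e(2)) blast
      then show False using y(2) by simp
    qed
    have "convex C" using C F(2) polytope_imp_convex by blast
    then have z: "x + t *\<^sub>R (y - x) \<in> C"
      using convexD_alt[OF _ xC C(2), of t] y by (simp add: algebra_simps)
    then show "x + t *\<^sub>R (y - x) \<in> X \<and> f (x + t *\<^sub>R (y - x)) = f x + t *\<^sub>R (f y - f x)"
      using affine_map_on_convex_combination[of C f x y t] F(3,4) C xC by blast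
  qed
qed

lemma closed_segment_iff_scaled:
  "z \<in> closed_segment x y \<longleftrightarrow> (\<exists>t. 0 \<le> t \<and> t \<le> 1 \<and> z = x + t *\<^sub>R (y - x))"
  unfolding in_segment by (simp add: algebra_simps)

lemma pl_cone_iff: "z \<in> pl_cone x K \<longleftrightarrow> z = x \<or> (\<exists>y\<in>K. z \<in> closed_segment x y)"
  unfolding pl_cone_def by blast

text \<open>\<open>L\<close> is compact and misses \<open>x\<close>, so it keeps a distance
  \<open>d\<close> from \<open>x\<close>. A point of the cone closer than \<open>e * d\<close>
  therefore has ray parameter below \<open>e\<close> and lies in the shrunken cone.\<close>

lemma nbhd_in_scaled_cone:
  fixes x :: "'a::euclidean_space"
  assumes "is_link x X L" "0 < e" "e \<le> 1"
  shows "nbhd_in X x (pl_cone x ((\<lambda>y. x + e *\<^sub>R (y - x)) ` L))"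
proof -
  let ?s = "\<lambda>y. x + e *\<^sub>R (y - x)"
  have L: "compact_polyhedron L" "x \<notin> L" "nbhd_in X x (pl_cone x L)"
    using assms(1) unfolding is_link_def by auto
  obtain d where d: "d > 0" "\<And>y. y \<in> L \<Longrightarrow> d \<le> dist x y"
    using separate_point_closed[of L x] L compact_polyhedron_compact compact_imp_closed by blast
  obtain r where r: "r > 0" "X \<inter> ball x r \<subseteq> pl_cone x L" "pl_cone x L \<subseteq> X" "x \<in> X"
    using L(3) unfolding nbhd_in_iff by blast
  have "X \<inter> ball x (min r (e * d)) \<subseteq> pl_cone x (?s ` L)"
  proof
    fix z assume z: "z \<in> X \<inter> ball x (min r (e * d))"
    then have "z \<in> pl_cone x L" using r(2) by auto
    then consider "z = x" | y where "y \<in> L" "z \<in> closed_segment x y" unfolding pl_cone_iff by blast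
    then show "z \<in> pl_cone x (?s ` L)"
    proof cases
      case 1
      then show ?thesis unfolding pl_cone_iff by blast
    next
      case 2
      then obtain t where t: "0 \<le> t" "t \<le> 1" "z = x + t *\<^sub>R (y - x)"
        unfolding closed_segment_iff_scaled by blast
      have "t * dist x y = dist x z" using t by (simp add: dist_norm norm_minus_commute)
      also have "\<dots> < e * d" using z by simp
      also have "\<dots> \<le> e * dist x y" using d(2)[OF 2(1)] assms by simp
      finally have "t < e" using d 2 by (metis mult_less_cancel_right zero_le_dist not_less)
      then have "z \<in> closed_segment x (?s y)"
        unfolding closed_segment_iff_scaled using t assms(2)
        by (intro exI[of _ "t / e"]) simp
      then show ?thesis unfolding pl_cone_iff using 2(1) by blast
    qed
  qed
  moreover have "pl_cone x (?s ` L) \<subseteq> X"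
  proof
    fix z assume "z \<in> pl_cone x (?s ` L)"
    then consider "z = x" | y where "y \<in> L" "z \<in> closed_segment x (?s y)" unfolding pl_cone_iff by blast
    then show "z \<in> X"
    proof cases
      case 2
      then obtain t where t: "0 \<le> t" "t \<le> 1" "z = x + (t * e) *\<^sub>R (y - x)"
        unfolding closed_segment_iff_scaled by auto
      then have "z \<in> closed_segment x y"
        unfolding closed_segment_iff_scaled using assms by (auto intro!: exI[of _ "t * e"] mult_le_one)
      then show ?thesis using r(3) 2(1) unfolding pl_cone_iff by (meson pl_cone_iff subsetD)
    qed (use r in simp)
  qed
  moreover have "x \<in> pl_cone x (?s ` L)" unfolding pl_cone_iff by blast
  ultimately show ?thesis unfolding nbhd_in_iff using r d assms(2)
    by (metis min_less_iff_conj mult_pos_pos)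
qed

text \<open>Since \<open>f\<close> is linear along short rays from \<open>x\<close>, it carries a shrunken star of \<open>x\<close> to a star.
  No uniqueness of links is involved.\<close>

lemma is_link_image:
  fixes X :: "'a::euclidean_space set" and Y :: "'b::euclidean_space set"
  assumes link: "is_link x X L" and N: "nbhd_in X x N" "nbhd_in Y (f x) (f ` N)"
    and f: "pl_on N f" "inj_on f N"
  obtains e0 where "e0 > 0"
    "\<And>e. 0 < e \<Longrightarrow> e < e0 \<Longrightarrow> is_link (f x) Y ((\<lambda>y. f (x + e *\<^sub>R (y - x))) ` L) \<and>
       pl_on L (\<lambda>y. f (x + e *\<^sub>R (y - x))) \<and> inj_on (\<lambda>y. f (x + e *\<^sub>R (y - x))) L"
proof -
  have L: "compact_polyhedron L" "x \<notin> L" "nbhd_in X x (pl_cone x L)"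
    "\<And>y z. y \<in> L \<Longrightarrow> z \<in> L \<Longrightarrow> y \<noteq> z \<Longrightarrow> closed_segment x y \<inter> closed_segment x z = {x}"
    using link unfolding is_link_def by auto
  obtain r where r: "r > 0" "X \<inter> ball x r \<subseteq> N" "x \<in> N" "N \<subseteq> X"
    using N(1) unfolding nbhd_in_iff by blast
  obtain c where c: "c > 0" "\<And>y t. y \<in> N \<Longrightarrow> dist x y < c \<Longrightarrow> 0 \<le> t \<Longrightarrow> t \<le> 1 \<Longrightarrow>
       x + t *\<^sub>R (y - x) \<in> N \<and> f (x + t *\<^sub>R (y - x)) = f x + t *\<^sub>R (f y - f x)"
    using pl_on_conical[OF f(1) r(3)] by blast
  have "bounded ((\<lambda>y. y - x) ` L)"
    using L(1) bounded_translation_minus compact_imp_bounded compact_polyhedron_compact by blast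
  then obtain b where b: "b > 0" "\<And>y. y \<in> L \<Longrightarrow> norm (y - x) \<le> b"
    unfolding bounded_pos by auto
  \<comment> \<open>With \<open>b\<close> bounding the distance of \<open>L\<close> from
    \<open>x\<close>, a scale below \<open>e0\<close> keeps the shrunken link within
    \<open>r\<close>, hence in \<open>N\<close>, and within \<open>c\<close>, where \<open>f\<close>
    is linear along the rays.\<close>
  define e0 where "e0 = min 1 (min r c / b)"
  have "e0 > 0" unfolding e0_def using r c b by auto
  then show ?thesis
  proof (rule that)
    fix e assume e: "0 < e" "e < e0"
    then have e1: "e \<le> 1" "e * b < r" "e * b < c"
      unfolding e0_def using b(1) by (auto simp: less_divide_eq)
    define s where "s = (\<lambda>y. x + e *\<^sub>R (y - x))"
    have nb: "nbhd_in X x (pl_cone x (s ` L))"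
      unfolding s_def using nbhd_in_scaled_cone[OF link e(1) e1(1)] .
    have dist: "dist x (s y) < r" "dist x (s y) < c" if "y \<in> L" for y
    proof -
      have "dist x (s y) = e * norm (y - x)" unfolding s_def using e by (simp add: dist_norm)
      also have "\<dots> \<le> e * b" using b(2)[OF that] e by simp
      finally show "dist x (s y) < r" "dist x (s y) < c" using e1 by auto
    qed
    have sN: "s y \<in> N" if "y \<in> L" for y
    proof -
      have "s y \<in> pl_cone x (s ` L)" unfolding pl_cone_iff using that by blast
      then have "s y \<in> X" using nb unfolding nbhd_in_iff by blast
      then show ?thesis using dist[OF that] r(2) by auto
    qed
    have seg: "closed_segment x (s y) \<subseteq> N"
      "f ` closed_segment x (s y) = closed_segment (f x) (f (s y))" if "y \<in> L" for y
    proof -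
      note cy = c(2)[OF sN[OF that] dist(2)[OF that]]
      show "closed_segment x (s y) \<subseteq> N" unfolding closed_segment_iff_scaled subset_iff using cy by blast
      show "f ` closed_segment x (s y) = closed_segment (f x) (f (s y))"
        unfolding set_eq_iff image_iff closed_segment_iff_scaled Bex_def using cy by metis
    qed
    have seg_sub: "closed_segment x (s y) \<subseteq> closed_segment x y" for y
    proof
      fix z assume "z \<in> closed_segment x (s y)"
      then obtain t where "0 \<le> t" "t \<le> 1" "z = x + (t * e) *\<^sub>R (y - x)"
        unfolding s_def closed_segment_iff_scaled by auto
      then show "z \<in> closed_segment x y"
        unfolding closed_segment_iff_scaled using e e1(1)
        by (intro exI[of _ "t * e"]) (auto intro: mult_le_one)
    qed
    have xs: "x \<noteq> s y" if "y \<in> L" for y using that L(2) e unfolding s_def by auto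
    have s: "pl_on L s" "inj_on s L"
      using e L(1) unfolding s_def by (auto intro!: pl_on_affine affine_map_on_homothety inj_onI)
    have fs: "pl_on L (\<lambda>y. f (s y))" using pl_on_compose[OF s(1) f(1)] sN by blast
    have fs_inj: "inj_on (\<lambda>y. f (s y)) L"
      using s(2) sN f(2) unfolding inj_on_def by blast
    have cone: "f ` pl_cone x (s ` L) = pl_cone (f x) (f ` s ` L)"
      by (rule pl_cone_image) (elim imageE, hypsubst, rule seg(2))
    have "pl_cone x (s ` L) \<subseteq> N" using seg(1) r(3) unfolding pl_cone_iff subset_iff by blast
    then have "nbhd_in N x (pl_cone x (s ` L))" using nbhd_in_subset nb r(4) by blast
    then have "nbhd_in (f ` N) (f x) (f ` pl_cone x (s ` L))"
      using nbhd_in_image[OF pl_on_homeomorphism[OF f]] by blast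
    then have nbY: "nbhd_in Y (f x) (pl_cone (f x) (f ` s ` L))"
      unfolding cone using N(2) nbhd_in_trans by blast
    have "is_link (f x) Y (f ` s ` L)"
      unfolding is_link_def
    proof (intro conjI ballI impI)
      show "compact_polyhedron (f ` s ` L)" using pl_on_image[OF fs] by (simp add: image_image)
      show "f x \<notin> f ` s ` L" using xs sN r(3) inj_onD[OF f(2)] by blast
      fix u v assume "u \<in> f ` s ` L" "v \<in> f ` s ` L" "u \<noteq> v"
      then obtain y z where yz: "y \<in> L" "z \<in> L" "u = f (s y)" "v = f (s z)" "y \<noteq> z" by blast
      have "closed_segment (f x) u \<inter> closed_segment (f x) v
          = f ` (closed_segment x (s y) \<inter> closed_segment x (s z))"
        using seg yz inj_on_image_Int[OF f(2)] by metis
      \<comment> \<open>Shrinking keeps every point on its own ray segment, so the shrunken cone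
        inherits embeddedness from the original one.\<close>
      also have "closed_segment x (s y) \<inter> closed_segment x (s z) = {x}"
        using L(4)[OF yz(1,2,5)] seg_sub by blast
      finally show "closed_segment (f x) u \<inter> closed_segment (f x) v = {f x}" by simp
    qed (rule nbY)
    then show "is_link (f x) Y ((\<lambda>y. f (x + e *\<^sub>R (y - x))) ` L) \<and>
       pl_on L (\<lambda>y. f (x + e *\<^sub>R (y - x))) \<and> inj_on (\<lambda>y. f (x + e *\<^sub>R (y - x))) L"
      using fs fs_inj unfolding s_def by (simp add: image_image)
  qed
qed

text \<open>A local PL homeomorphism at \<open>x\<close> that matches the subpolyhedra
  \<open>P\<close> and \<open>Q\<close> near the point. The data are symmetric under inversion, so
  each transfer result serves both the covering map and its local inverse.\<close>

definition pl_chart ::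
  "('a::euclidean_space \<Rightarrow> 'b::euclidean_space) \<Rightarrow> 'a \<Rightarrow> 'a set \<Rightarrow> 'a set \<Rightarrow> 'a set \<Rightarrow>
     'b set \<Rightarrow> 'b set \<Rightarrow> bool" where
  "pl_chart f x N X P Y Q \<longleftrightarrow> nbhd_in X x N \<and> nbhd_in Y (f x) (f ` N) \<and> pl_on N f \<and> inj_on f N \<and>
     x \<in> P \<and> P \<subseteq> X \<and> Q \<subseteq> Y \<and> compact_polyhedron P \<and> compact_polyhedron Q \<and>
     f ` (P \<inter> N) = Q \<inter> f ` N"

lemma nbhd_in_Int:
  fixes X :: "'a::metric_space set"
  shows "nbhd_in X x N \<Longrightarrow> A \<subseteq> X \<Longrightarrow> x \<in> A \<Longrightarrow> nbhd_in A x (A \<inter> N)"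
  unfolding nbhd_in_iff by blast

text \<open>Restricted to \<open>P\<close>, a chart is itself a local PL homeomorphism onto a
  neighbourhood in \<open>Q\<close>, so \<open>is_link_image\<close> applies to links in the
  subpolyhedra as well as in the ambient spaces.\<close>

lemma pl_chart_restrict:
  assumes "pl_chart f x N X P Y Q"
  shows "nbhd_in P x (P \<inter> N)" "nbhd_in Q (f x) (f ` (P \<inter> N))" "pl_on (P \<inter> N) f" "inj_on f (P \<inter> N)"
proof -
  note c = assms[unfolded pl_chart_def]
  have x: "x \<in> P \<inter> N" using c unfolding nbhd_in_iff by blast
  show "nbhd_in P x (P \<inter> N)" using c x by (intro nbhd_in_Int[of X]) auto
  have "f x \<in> Q \<inter> f ` N" using c x by blast
  then have "nbhd_in Q (f x) (Q \<inter> f ` N)" using c by (intro nbhd_in_Int[of Y]) auto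
  then show "nbhd_in Q (f x) (f ` (P \<inter> N))" using c by simp
  have N: "pl_on N f" and P: "compact_polyhedron P" using c by blast+
  show "pl_on (P \<inter> N) f"
    using N compact_polyhedron_Int[OF P pl_on_compact_polyhedron[OF N]] by (rule pl_on_subset) blast
  have "inj_on f N" using c by blast
  then show "inj_on f (P \<inter> N)" by (rule inj_on_subset) blast
qed

lemma pl_chart_inverse:
  assumes "pl_chart f x N X P Y Q"
  shows "pl_chart (inv_into N f) (f x) (f ` N) Y Q X P"
proof -
  let ?g = "inv_into N f"
  note c = assms[unfolded pl_chart_def]
  have "pl_on N f" "inj_on f N" using c by auto
  note g = pl_homeomorphismD[OF pl_homeomorphismI[OF this refl]]
  have x: "x \<in> N" using c unfolding nbhd_in_iff by blast
  have "?g ` (Q \<inter> f ` N) = ?g ` f ` (P \<inter> N)" using c by simp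
  also have "\<dots> = P \<inter> N" using c by (intro inv_into_image_cancel) auto
  finally have "?g ` (Q \<inter> f ` N) = P \<inter> ?g ` f ` N" using g(4) by simp
  moreover have "f x \<in> Q" using c x by blast
  moreover have "?g (f x) = x" using g(7) x by simp
  ultimately show ?thesis unfolding pl_chart_def using c g(2,4,6) by simp
qed

text \<open>A shrunken link is carried to a link of the image, and the two model simplices are
  replaced by ones in the target types. The bound on \<open>m\<close> provides room for
  them.\<close>

lemma point_of_type_chart:
  fixes x :: "'a::euclidean_space" and f :: "'a \<Rightarrow> 'b::euclidean_space"
  assumes "pl_chart f x N X P Y Q" "point_of_type m k P x" "m \<le> DIM('b)"
  shows "point_of_type m k Q (f x)"
proof -
  obtain L and \<Delta> :: "('a \<times> real) set" and T :: "'a set" where *: "k \<le> m" "is_link x P L"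
      "int (m - k + 1) simplex \<Delta>" "int k simplex T" "pl_homeomorphic L (bd_Pi_model \<Delta> T)"
    using assms(2) unfolding point_of_type_def by blast
  note r = pl_chart_restrict[OF assms(1)]
  obtain e0 where e0: "e0 > 0"
    "\<And>e. 0 < e \<Longrightarrow> e < e0 \<Longrightarrow> is_link (f x) Q ((\<lambda>y. f (x + e *\<^sub>R (y - x))) ` L) \<and>
       pl_on L (\<lambda>y. f (x + e *\<^sub>R (y - x))) \<and> inj_on (\<lambda>y. f (x + e *\<^sub>R (y - x))) L"
    using is_link_image[OF *(2) r] by blast
  define e where "e = e0 / 2"
  define g where "g = (\<lambda>y. f (x + e *\<^sub>R (y - x)))"
  have g: "is_link (f x) Q (g ` L)" "pl_on L g" "inj_on g L"
    using e0(2)[of e] e0(1) unfolding g_def e_def by auto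
  \<comment> \<open>The extra real factor supplies the one dimension by which
    \<open>m - k + 1\<close> can exceed \<open>m\<close>.\<close>
  have "m - k + 1 \<le> DIM('b \<times> real)" using assms(3) by simp
  then obtain \<Delta>' :: "('b \<times> real) set" where D': "int (m - k + 1) simplex \<Delta>'"
    using simplex_exists by blast
  obtain T' :: "'b set" where T': "int k simplex T'"
    using simplex_exists[of k, where 'a='b] assms(3) *(1) by auto
  have "\<Delta> \<noteq> {}" using *(3) by auto
  then have "pl_homeomorphic (bd_Pi_model \<Delta> T) (bd_Pi_model \<Delta>' T')"
    using bd_Pi_model_homeomorphic[OF *(3) D' *(4) T']
      pl_homeomorphic_compact_polyhedron[OF pl_homeomorphic_sym[OF *(5)]] by blast
  with *(5) have "pl_homeomorphic L (bd_Pi_model \<Delta>' T')" by (rule pl_homeomorphic_trans)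
  with pl_homeomorphic_sym[OF pl_homeomorphicI[OF g(2,3) refl]]
  have "pl_homeomorphic (g ` L) (bd_Pi_model \<Delta>' T')" by (rule pl_homeomorphic_trans)
  moreover have "f x \<in> Q" using r(2) unfolding nbhd_in_iff by blast
  ultimately show ?thesis unfolding point_of_type_def using *(1) g(1) D' T' by blast
qed

text \<open>Transport along \<open>g\<close> leaves both sets of suspension exponents unchanged, so
  their maxima stay equal without being computed.\<close>

lemma unknotted_chart:
  fixes x :: "'a::euclidean_space" and f :: "'a \<Rightarrow> 'b::euclidean_space"
  assumes "pl_chart f x N X P Y Q"
    and "is_link_pair x X P L L'"
    and "Max {t. is_suspension_pair t L L'} = Max {t. is_suspension t L'}"
  shows "\<exists>K K'. is_link_pair (f x) Y Q K K' \<and>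
      Max {t. is_suspension_pair t K K'} = Max {t. is_suspension t K'}"
proof -
  have L: "is_link x X L" "is_link x P L'" "L' \<subseteq> L" using assms(2) unfolding is_link_pair_def by auto
  have c: "nbhd_in X x N" "nbhd_in Y (f x) (f ` N)" "pl_on N f" "inj_on f N"
    using assms(1) unfolding pl_chart_def by auto
  let ?s = "\<lambda>e y. f (x + e *\<^sub>R (y - x))"
  obtain e0 where e0: "e0 > 0" "\<And>e. 0 < e \<Longrightarrow> e < e0 \<Longrightarrow>
      is_link (f x) Y (?s e ` L) \<and> pl_on L (?s e) \<and> inj_on (?s e) L"
    using is_link_image[OF L(1) c] by blast
  obtain e1 where e1: "e1 > 0" "\<And>e. 0 < e \<Longrightarrow> e < e1 \<Longrightarrow>
      is_link (f x) Q (?s e ` L') \<and> pl_on L' (?s e) \<and> inj_on (?s e) L'"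
    using is_link_image[OF L(2) pl_chart_restrict[OF assms(1)]] by blast
  \<comment> \<open>A common scale below both bounds makes one and the same map carry
    \<open>L\<close> and \<open>L'\<close>, so the inclusion between the links survives.\<close>
  define g where "g = ?s (min e0 e1 / 2)"
  have g: "is_link (f x) Y (g ` L)" "pl_on L g" "inj_on g L"
    using e0(2)[of "min e0 e1 / 2"] e0(1) e1(1) unfolding g_def by auto
  have g': "is_link (f x) Q (g ` L')" "pl_on L' g" "inj_on g L'"
    using e1(2)[of "min e0 e1 / 2"] e0(1) e1(1) unfolding g_def by auto
  have "is_link_pair (f x) Y Q (g ` L) (g ` L')"
    unfolding is_link_pair_def using g(1) g'(1) L(3) by blast
  moreover have "Max {t. is_suspension_pair t (g ` L) (g ` L')} = Max {t. is_suspension t (g ` L')}"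
    using assms(3) is_suspension_image_iff[OF g'(2,3)] is_suspension_pair_image_iff[OF g(2,3) L(3)]
    by simp
  ultimately show ?thesis by blast
qed

section \<open>Lifting along a covering\<close>

text \<open>Covering theory gives only an open set on which \<open>p\<close> is injective; cutting
  \<open>M'\<close> with a small closed box inside it makes the domain polyhedral.\<close>

lemma pl_covering_chart:
  fixes p :: "'b::euclidean_space \<Rightarrow> 'a::euclidean_space"
  assumes "pl_covering d M' p M" "compact_polyhedron P" "P \<subseteq> M" "x \<in> M'" "p x \<in> P"
  obtains N where "pl_chart p x N M' (M' \<inter> p -` P) M P"
proof -
  have cov: "covering_space M' p M" and pl: "pl_on M' p"
    using assms(1) unfolding pl_covering_def by auto
  obtain T u q where T: "x \<in> T" "openin (top_of_set M') T" "p x \<in> u" "openin (top_of_set M) u"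
      "homeomorphism T u p q"
    using covering_space_local_homeomorphism[OF cov assms(4)] by metis
  obtain V where V: "open V" "T = M' \<inter> V" using T(2) by (auto simp: openin_open)
  then have "x \<in> V" using T(1) by blast
  then obtain a b where ab: "cbox a b \<subseteq> V" "x \<in> box a b" by (rule open_contains_cbox[OF V(1)])
  define N where "N = M' \<inter> cbox a b"
  have NT: "N \<subseteq> T" unfolding N_def using V ab by blast
  have "nbhd_in M' x N"
    unfolding nbhd_in_def N_def using ab(2) assms(4) box_subset_cbox[of a b]
    by (intro conjI exI[of _ "M' \<inter> box a b"]) auto
  moreover have "nbhd_in M (p x) (p ` N)"
  proof -
    have "T \<subseteq> M'" using V by blast
    then have "nbhd_in T x N" using nbhd_in_subset[OF \<open>nbhd_in M' x N\<close> NT] by blast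
    then have "nbhd_in u (p x) (p ` N)" using nbhd_in_image[OF T(5)] by blast
    moreover have "nbhd_in M (p x) u"
      unfolding nbhd_in_def using T(3,4) openin_subset[OF T(4)] by auto
    ultimately show ?thesis using nbhd_in_trans by blast
  qed
  moreover have "compact_polyhedron N"
    unfolding N_def using pl_on_compact_polyhedron[OF pl] compact_polyhedron_polytope[OF polytope_interval]
    by (rule compact_polyhedron_Int)
  then have "pl_on N p" using pl pl_on_subset unfolding N_def by blast
  moreover have "inj_on p N"
    using T(5) NT unfolding homeomorphism_def by (intro inj_on_inverseI[where g=q]) auto
  moreover have "compact_polyhedron (M' \<inter> p -` P)"
    using pl_on_vimage[OF pl assms(2)] by (simp add: vimage_def Int_def)
  moreover have "p ` ((M' \<inter> p -` P) \<inter> N) = P \<inter> p ` N" unfolding N_def by auto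
  ultimately have "pl_chart p x N M' (M' \<inter> p -` P) M P"
    unfolding pl_chart_def using assms(2-5) by auto
  then show ?thesis by (rule that)
qed

section \<open>Preimages of polyhedra and the sheets over a ball\<close>

lemma pl_covering_vimage:
  assumes "pl_covering d M' p M" "compact_polyhedron A"
  shows "compact_polyhedron (M' \<inter> p -` A)"
  using pl_on_vimage[OF _ assms(2), of M' p] assms(1)
  unfolding pl_covering_def by (simp add: vimage_def Int_def)

lemma pl_covering_image_vimage:
  assumes "pl_covering d M' p M" "A \<subseteq> M"
  shows "p ` (M' \<inter> p -` A) = A"
proof -
  have "p ` M' = M" using assms covering_space_imp_surjective unfolding pl_covering_def by blast
  then show ?thesis using assms(2) by auto
qed

text \<open>Cells are connected, so a cell meeting one of finitely many disjoint closed pieces lies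
  entirely in it; each piece is a union of cells. Applied to the sheets over a ball, this gives
  polyhedrality although the lifts are only known to be continuous.\<close>

lemma compact_polyhedron_separated_piece:
  assumes "compact_polyhedron E" "finite \<B>" "pairwise disjnt \<B>" "\<Union>\<B> = E" "\<forall>B\<in>\<B>. closed B" "B \<in> \<B>"
  shows "compact_polyhedron B"
proof -
  obtain F where F: "finite F" "\<forall>C\<in>F. polytope C" "\<Union>F = E"
    using assms(1) unfolding compact_polyhedron_def by blast
  have "C \<subseteq> B" if C: "C \<in> F" "C \<inter> B \<noteq> {}" for C
  proof -
    let ?R = "\<Union>(\<B> - {B})"
    have "connected C" using C F(2) polytope_imp_convex convex_connected by blast
    moreover have "closed B" "closed ?R" using assms(2,5,6) by (auto intro!: closed_Union)
    moreover have "C \<subseteq> B \<union> ?R" using C(1) F(3) assms(4,6) by blast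
    moreover have "B \<inter> ?R \<inter> C = {}"
      using assms(3,6) unfolding pairwise_def disjnt_def by blast
    ultimately have "C \<inter> ?R = {}" using C(2) unfolding connected_closed by (metis Int_commute)
    then show ?thesis using \<open>C \<subseteq> B \<union> ?R\<close> by blast
  qed
  then have "B = \<Union>{C \<in> F. C \<subseteq> B}" using F(3) assms(4,6) by blast
  then show ?thesis unfolding compact_polyhedron_def
    using F(1,2) by (intro exI[of _ "{C \<in> F. C \<subseteq> B}"]) auto
qed

lemma pl_ball_topology:
  fixes B :: "'a::euclidean_space set"
  assumes "pl_ball n B"
  shows "compact_polyhedron B" "B \<noteq> {}" "simply_connected B" "locally path_connected B"
proof -
  obtain \<Delta> :: "'a set" and f g where D: "int n simplex \<Delta>" "pl_homeomorphism B \<Delta> f g"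
    using assms unfolding pl_ball_def pl_homeomorphic_def by blast
  have hom: "\<Delta> homeomorphic B"
    using D(2) homeomorphism_symD unfolding pl_homeomorphism_def homeomorphic_def by blast
  have "convex \<Delta>" using D(1) by (rule convex_simplex)
  then show "simply_connected B"
    using hom homeomorphic_simply_connected convex_imp_simply_connected by blast
  have "locally path_connected \<Delta> \<longleftrightarrow> locally path_connected B"
    using hom homeomorphic_path_connectedness by (rule homeomorphic_locally)
  then show "locally path_connected B"
    using \<open>convex \<Delta>\<close> convex_imp_locally_path_connected by blast
  show "compact_polyhedron B" using pl_homeomorphismD(1)[OF D(2)] pl_on_compact_polyhedron by blast
  show "B \<noteq> {}" using D(1) pl_homeomorphismD(3)[OF D(2)] by auto
qed

text \<open>The sheets over a ball are the images of the lifts of its inclusion.\<close>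

lemma pl_covering_sheets:
  fixes p :: "'b::euclidean_space \<Rightarrow> 'a::euclidean_space"
  assumes "pl_covering d M' p M" "pl_ball n B" "B \<subseteq> M"
  obtains \<B> where "finite \<B>" "pairwise disjnt \<B>" "\<Union>\<B> = M' \<inter> p -` B"
    "\<And>B'. B' \<in> \<B> \<Longrightarrow> compact_polyhedron B' \<and> pl_on B' p \<and> inj_on p B' \<and> p ` B' = B"
proof -
  have cov: "covering_space M' p M" and pl: "pl_on M' p"
    using assms(1) unfolding pl_covering_def by auto
  note B = pl_ball_topology[OF assms(2)]
  obtain b0 where b0: "b0 \<in> B" using B(2) by blast
  \<comment> \<open>Each lift of the ball is determined by its value at the base point
    \<open>b0\<close>, so this finite fibre indexes the sheets.\<close>
  define \<Phi> where "\<Phi> = {a \<in> M'. p a = b0}"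
  have fin: "finite \<Phi>" using assms(1,3) b0 unfolding pl_covering_def \<Phi>_def by auto
  have conn: "connected B" using B(3) simply_connected_imp_connected by blast
  have idB: "continuous_on B (\<lambda>x. x)" "(\<lambda>x. x) \<in> B \<rightarrow> M" using assms(3) by auto
  have lift: "\<exists>g. continuous_on B g \<and> g \<in> B \<rightarrow> M' \<and> g (p a) = a \<and> (\<forall>y\<in>B. p (g y) = y)"
    if "a \<in> M'" "p a \<in> B" for a
    using covering_space_lift_strong[OF cov that B(3,4) idB refl] by metis
  then obtain g where g: "\<And>a. a \<in> \<Phi> \<Longrightarrow>
      continuous_on B (g a) \<and> g a \<in> B \<rightarrow> M' \<and> g a b0 = a \<and> (\<forall>y\<in>B. p (g a y) = y)"
    using b0 unfolding \<Phi>_def by (metis (mono_tags, lifting) mem_Collect_eq)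
  have uniq: "g1 y = g2 y"
    if "continuous_on B g1" "g1 \<in> B \<rightarrow> M'" "\<forall>y\<in>B. p (g1 y) = y"
      "continuous_on B g2" "g2 \<in> B \<rightarrow> M'" "\<forall>y\<in>B. p (g2 y) = y" "z \<in> B" "g1 z = g2 z" "y \<in> B" for g1 g2 y z
    by (rule covering_space_lift_unique[OF cov that(8) idB that(1,2) _ that(4,5) _ conn that(7,9)])
      (use that in auto)
  define \<B> where "\<B> = (\<lambda>a. g a ` B) ` \<Phi>"
  have 1: "finite \<B>" unfolding \<B>_def using fin by blast
  have 2: "pairwise disjnt \<B>"
  proof (rule pairwiseI)
    fix S T assume "S \<in> \<B>" "T \<in> \<B>" "S \<noteq> T"
    then obtain a c where ac: "a \<in> \<Phi>" "c \<in> \<Phi>" "S = g a ` B" "T = g c ` B" unfolding \<B>_def by blast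
    show "disjnt S T"
    proof (rule ccontr)
      assume "\<not> disjnt S T"
      then obtain y z where yz: "y \<in> B" "z \<in> B" "g a y = g c z" unfolding disjnt_def ac by blast
      \<comment> \<open>Applying \<open>p\<close> to the common value shows that the two lifts agree
        at one point of the ball, so by uniqueness they agree everywhere.\<close>
      then have "y = z" using g[OF ac(1)] g[OF ac(2)] by metis
      then have "g a w = g c w" if "w \<in> B" for w
        using uniq[of "g a" "g c" y w] g[OF ac(1)] g[OF ac(2)] yz that by blast
      then have "S = T" unfolding ac by (intro image_cong) auto
      then show False using \<open>S \<noteq> T\<close> by blast
    qed
  qed
  have 3: "\<Union>\<B> = M' \<inter> p -` B"
  proof (intro equalityI subsetI)
    fix y assume "y \<in> \<Union>\<B>"
    then obtain a z where "a \<in> \<Phi>" "z \<in> B" "y = g a z" unfolding \<B>_def by blast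
    then show "y \<in> M' \<inter> p -` B" using g[of a] by auto
  next
    fix y assume "y \<in> M' \<inter> p -` B"
    then have y: "y \<in> M'" "p y \<in> B" by auto
    obtain k where k: "continuous_on B k" "k \<in> B \<rightarrow> M'" "k (p y) = y" "\<forall>y\<in>B. p (k y) = y"
      using lift[OF y] by blast
    have a: "k b0 \<in> \<Phi>" using k b0 unfolding \<Phi>_def by auto
    \<comment> \<open>The lift through \<open>y\<close> starts at some point of the fibre over
      \<open>b0\<close>, where it meets the lift chosen there; hence \<open>y\<close> lies on a
      listed sheet.\<close>
    have "k (p y) = g (k b0) (p y)"
      using uniq[OF k(1,2,4), of "g (k b0)" b0 "p y"] g[OF a] b0 y(2) by auto
    then show "y \<in> \<Union>\<B>" unfolding \<B>_def using a y(2) k(3) by (metis UnionI imageI)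
  qed
  have closed: "\<forall>B'\<in>\<B>. closed B'"
    unfolding \<B>_def using g compact_polyhedron_compact[OF B(1)]
    by (auto intro!: compact_imp_closed compact_continuous_image)
  show ?thesis
  proof (rule that[OF 1 2 3])
    fix B' assume B': "B' \<in> \<B>"
    then obtain a where a: "a \<in> \<Phi>" "B' = g a ` B" unfolding \<B>_def by blast
    have cp: "compact_polyhedron B'"
      using pl_covering_vimage[OF assms(1) B(1)] 1 2 3 closed B'
      by (rule compact_polyhedron_separated_piece)
    have "B' \<subseteq> M'" using B' 3 by blast
    then have "pl_on B' p" using pl cp pl_on_subset by blast
    moreover have "inj_on p B'" unfolding a(2) using g[OF a(1)] by (intro inj_onI) auto
    moreover have "p ` B' = B" unfolding a(2) image_image using g[OF a(1)] by simp
    ultimately show "compact_polyhedron B' \<and> pl_on B' p \<and> inj_on p B' \<and> p ` B' = B"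
      using cp by blast
  qed
qed

section \<open>Lifting collapses, discs and spines\<close>

lemma pl_ball_sheet:
  assumes "pl_on B' p" "inj_on p B'" "pl_ball n (p ` B')"
  shows "pl_ball n B'"
  using pl_ball_homeomorphic[OF assms(3) pl_homeomorphic_sym[OF pl_homeomorphicI[OF assms(1,2) refl]]] .

text \<open>The sheets over the collapsing ball are collapsed one after the other.\<close>

lemma elementary_collapse_lift:
  fixes p :: "'b::euclidean_space \<Rightarrow> 'a::euclidean_space"
  assumes cov: "pl_covering d M' p M" and "elementary_collapse X Y" "X \<subseteq> M"
  shows "collapses_onto (M' \<inter> p -` X) (M' \<inter> p -` Y)"
proof -
  obtain k B where cp: "compact_polyhedron X" "compact_polyhedron Y"
    and B: "pl_ball (Suc k) B" "X = Y \<union> B" "pl_ball k (Y \<inter> B)" "Y \<inter> B \<subseteq> pl_boundary (Suc k) B"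
    using assms(2) unfolding elementary_collapse_def by blast
  have BM: "B \<subseteq> M" using B(2) assms(3) by blast
  obtain \<B> where \<B>: "finite \<B>" "pairwise disjnt \<B>" "\<Union>\<B> = M' \<inter> p -` B"
    "\<And>B'. B' \<in> \<B> \<Longrightarrow> compact_polyhedron B' \<and> pl_on B' p \<and> inj_on p B' \<and> p ` B' = B"
    using pl_covering_sheets[OF cov B(1) BM] by blast
  let ?Y = "M' \<inter> p -` Y"
  have Ycp: "compact_polyhedron ?Y" using cov cp(2) by (rule pl_covering_vimage)
  \<comment> \<open>Stated for an arbitrary set of sheets so that they can be added one at a time;
    all of them together with \<open>?Y\<close> give the preimage of \<open>X\<close>.\<close>
  have "collapses_onto (?Y \<union> \<Union>\<C>) ?Y" if "finite \<C>" "\<C> \<subseteq> \<B>" for \<C>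
    using that
  proof (induction \<C>)
    case empty
    then show ?case by (simp add: collapses_onto_def)
  next
    case (insert B' \<C>)
    have b: "compact_polyhedron B'" "pl_on B' p" "inj_on p B'" "p ` B' = B"
      using \<B>(4)[of B'] insert.prems by auto
    let ?Z = "?Y \<union> \<Union>\<C>"
    have Zcp: "compact_polyhedron ?Z"
      using Ycp compact_polyhedron_UN[of \<C> id] insert \<B>(4) by (auto intro!: compact_polyhedron_Un)
    have "B' \<inter> C = {}" if "C \<in> \<C>" for C
    proof -
      have "B' \<in> \<B>" "C \<in> \<B>" "B' \<noteq> C" using insert.hyps(2) insert.prems that by auto
      then show ?thesis using pairwiseD[OF \<B>(2)] unfolding disjnt_def by blast
    qed
    \<comment> \<open>The sheets are disjoint, so those still present do not enlarge the face along
      which \<open>B'\<close> collapses.\<close>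
    then have int: "?Z \<inter> B' = ?Y \<inter> B'" by blast
    have "B' \<subseteq> M'" using \<B>(3) insert.prems by blast
    then have im: "p ` (?Y \<inter> B') = Y \<inter> B" using b(4) by auto
    have intcp: "compact_polyhedron (?Y \<inter> B')" using Ycp b(1) by (rule compact_polyhedron_Int)
    have "elementary_collapse (?Z \<union> B') ?Z"
      unfolding elementary_collapse_def
    proof (intro conjI exI)
      show "compact_polyhedron (?Z \<union> B')" using Zcp b(1) by (rule compact_polyhedron_Un)
      show "pl_ball (Suc k) B'" using pl_ball_sheet[OF b(2,3)] b(4) B(1) by simp
      show "pl_ball k (?Z \<inter> B')"
        unfolding int
      proof (rule pl_ball_sheet)
        show "pl_on (?Y \<inter> B') p" using b(2) intcp by (rule pl_on_subset) blast
        show "inj_on p (?Y \<inter> B')" using b(3) by (rule inj_on_subset) blast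
        show "pl_ball k (p ` (?Y \<inter> B'))" unfolding im by (rule B(3))
      qed
      \<comment> \<open>\<open>p\<close> maps the boundary of \<open>B'\<close> onto that of
        \<open>B\<close>. The given point and some boundary point of \<open>B'\<close> have the same
        image, so injectivity on the sheet identifies them.\<close>
      show "?Z \<inter> B' \<subseteq> pl_boundary (Suc k) B'"
      proof
        fix y assume "y \<in> ?Z \<inter> B'"
        then have y: "y \<in> B'" "p y \<in> Y \<inter> B" using int im by blast+
        then have "p y \<in> p ` pl_boundary (Suc k) B'"
          using B(4) pl_boundary_image[OF b(2,3), of "Suc k"] b(4) by auto
        then obtain z where "z \<in> pl_boundary (Suc k) B'" "p y = p z" by blast
        moreover have "pl_boundary (Suc k) B' \<subseteq> B'" unfolding pl_boundary_def by blast
        ultimately show "y \<in> pl_boundary (Suc k) B'" using inj_onD[OF b(3)] y(1) by blast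
      qed
    qed (use Zcp in auto)
    moreover have "?Z \<union> B' = ?Y \<union> \<Union>(insert B' \<C>)" by blast
    ultimately show ?case using insert unfolding collapses_onto_def
      by (metis converse_rtranclp_into_rtranclp insert_subset)
  qed
  from this[OF \<B>(1) order_refl] have "collapses_onto (?Y \<union> (M' \<inter> p -` B)) ?Y" unfolding \<B>(3) .
  moreover have "?Y \<union> (M' \<inter> p -` B) = M' \<inter> p -` X" using B(2) by blast
  ultimately show ?thesis by simp
qed

text \<open>The induction removes collapses from the larger end, because the inclusion in
  \<open>M\<close> passes from each space to the smaller next one.\<close>

lemma collapses_onto_lift:
  assumes cov: "pl_covering d M' p M" and "collapses_onto X Y" "X \<subseteq> M"
  shows "collapses_onto (M' \<inter> p -` X) (M' \<inter> p -` Y)"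
  using assms(2,3) unfolding collapses_onto_def
proof (induction rule: converse_rtranclp_induct)
  case base
  then show ?case by simp
next
  case (step X Z)
  have "Z \<subseteq> M" using step unfolding elementary_collapse_def by blast
  then show ?case
    using elementary_collapse_lift[OF cov step(1) step.prems] step(3)
    unfolding collapses_onto_def by (meson rtranclp_trans)
qed

text \<open>The chart is taken with \<open>P = M\<close> and inverted, so that its local inverse
  carries an interior point of \<open>M\<close> up to \<open>x\<close>.\<close>

lemma pl_interior_lift:
  assumes "pl_covering d M' p M" "pl_manifold n M" "x \<in> M'" "p x \<in> pl_interior n M"
  shows "x \<in> pl_interior n M'"
proof -
  have M: "compact_polyhedron M" using assms(2) unfolding pl_manifold_def by blast
  have "p x \<in> M" using assms(4) pl_interior_subset by blast
  then obtain N where N: "pl_chart p x N M' (M' \<inter> p -` M) M M"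
    using pl_covering_chart[OF assms(1) M order_refl assms(3)] by blast
  let ?q = "inv_into N p"
  have "pl_chart ?q (p x) (p ` N) M M M' (M' \<inter> p -` M)" using N by (rule pl_chart_inverse)
  then have "nbhd_in M (p x) (p ` N)" "nbhd_in M' (?q (p x)) (?q ` p ` N)"
      "pl_on (p ` N) ?q" "inj_on ?q (p ` N)"
    unfolding pl_chart_def by blast+
  with assms(4) have "?q (p x) \<in> pl_interior n M'" by (rule pl_interior_local_image)
  moreover have "?q (p x) = x" using N unfolding pl_chart_def nbhd_in_iff by simp
  ultimately show ?thesis by simp
qed

lemma is_spine_lift:
  fixes p :: "'b::euclidean_space \<Rightarrow> 'a::euclidean_space"
  assumes cov: "pl_covering d M' p M" and M: "pl_manifold n M" and "is_spine n M P"
  shows "is_spine n M' (M' \<inter> p -` P)"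
proof -
  obtain \<D> where cp: "compact_polyhedron P" "P \<subseteq> pl_interior n M"
    and D: "finite \<D>" "pairwise disjnt \<D>"
      "\<And>D. D \<in> \<D> \<Longrightarrow> pl_ball n D \<and> D \<subseteq> pl_interior n M \<and> disjnt D P"
      "collapses_onto (M - (\<Union>D\<in>\<D>. pl_interior n D)) P"
    using assms(3) unfolding is_spine_def by blast
  have int: "M' \<inter> p -` A \<subseteq> pl_interior n M'" if "A \<subseteq> pl_interior n M" for A
    using pl_interior_lift[OF cov M] that by blast
  have "\<exists>\<B>. finite \<B> \<and> pairwise disjnt \<B> \<and> \<Union>\<B> = M' \<inter> p -` D \<and>
      (\<forall>B'\<in>\<B>. pl_on B' p \<and> inj_on p B' \<and> p ` B' = D)" if "D \<in> \<D>" for D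
  proof -
    have "D \<subseteq> M" using D(3)[OF that] pl_interior_subset by blast
    then show ?thesis using pl_covering_sheets[OF cov, of n D] D(3)[OF that] by metis
  qed
  then obtain L where L: "\<And>D. D \<in> \<D> \<Longrightarrow> finite (L D) \<and> pairwise disjnt (L D) \<and>
      \<Union>(L D) = M' \<inter> p -` D \<and> (\<forall>B'\<in>L D. pl_on B' p \<and> inj_on p B' \<and> p ` B' = D)"
    by metis
  define \<D>' where "\<D>' = (\<Union>D\<in>\<D>. L D)"
  have "finite \<D>'" unfolding \<D>'_def using D(1) L by blast
  moreover have "pairwise disjnt \<D>'"
  proof (rule pairwiseI)
    fix S T assume ST: "S \<in> \<D>'" "T \<in> \<D>'" "S \<noteq> T"
    then obtain D E where DE: "D \<in> \<D>" "E \<in> \<D>" "S \<in> L D" "T \<in> L E" unfolding \<D>'_def by blast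
    show "disjnt S T"
    proof (cases "D = E")
      case True
      then show ?thesis using DE L[OF DE(1)] ST(3) unfolding pairwise_def by blast
    next
      case False
      then have "disjnt D E" using D(2) DE unfolding pairwise_def by blast
      moreover have "p ` S = D" "p ` T = E" using L DE by blast+
      ultimately show ?thesis unfolding disjnt_def by blast
    qed
  qed
  moreover have "pl_ball n B' \<and> B' \<subseteq> pl_interior n M' \<and> disjnt B' (M' \<inter> p -` P)" if B': "B' \<in> \<D>'" for B'
  proof -
    obtain D0 where D0: "D0 \<in> \<D>" "B' \<in> L D0" using B' unfolding \<D>'_def by blast
    then have b: "pl_on B' p" "inj_on p B'" "p ` B' = D0" using L by auto
    have "pl_ball n B'" using pl_ball_sheet[OF b(1,2)] b(3) D(3)[OF D0(1)] by simp
    moreover have "B' \<subseteq> M' \<inter> p -` D0" using L[OF D0(1)] D0(2) by blast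
    then have "B' \<subseteq> pl_interior n M'" using int D(3)[OF D0(1)] by blast
    moreover have "disjnt B' (M' \<inter> p -` P)"
      using b(3) D(3)[OF D0(1)] unfolding disjnt_def by blast
    ultimately show ?thesis by blast
  qed
  \<comment> \<open>The lift of collapses starts from an exact preimage. Equality holds because
    \<open>p\<close> is a PL homeomorphism from each sheet to its disc, so a point of
    \<open>M'\<close> is interior to a sheet exactly when its image is interior to a disc.\<close>
  moreover have "M' - (\<Union>B'\<in>\<D>'. pl_interior n B') = M' \<inter> p -` (M - (\<Union>D\<in>\<D>. pl_interior n D))"
  proof -
    have pM: "p ` M' = M"
      using cov covering_space_imp_surjective unfolding pl_covering_def by blast
    have "x \<in> (\<Union>B'\<in>\<D>'. pl_interior n B') \<longleftrightarrow> p x \<in> (\<Union>D\<in>\<D>. pl_interior n D)" if x: "x \<in> M'" for x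
    proof
      assume "x \<in> (\<Union>B'\<in>\<D>'. pl_interior n B')"
      then obtain D0 B' where *: "D0 \<in> \<D>" "B' \<in> L D0" "x \<in> pl_interior n B'" unfolding \<D>'_def by blast
      then have "pl_on B' p" "inj_on p B'" "p ` B' = D0" using L by auto
      then have "p ` pl_interior n B' = pl_interior n D0" using pl_interior_image by metis
      then show "p x \<in> (\<Union>D\<in>\<D>. pl_interior n D)" using * by blast
    next
      assume "p x \<in> (\<Union>D\<in>\<D>. pl_interior n D)"
      then obtain D0 where *: "D0 \<in> \<D>" "p x \<in> pl_interior n D0" by blast
      then have "x \<in> M' \<inter> p -` D0" using x pl_interior_subset[of n D0] by blast
      then obtain B' where B': "B' \<in> L D0" "x \<in> B'" using L[OF *(1)] by blast
      then have b: "pl_on B' p" "inj_on p B'" "p ` B' = D0" using L *(1) by auto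
      then have "p ` pl_interior n B' = pl_interior n D0" using pl_interior_image by metis
      then obtain z where z: "z \<in> pl_interior n B'" "p x = p z" using *(2) by blast
      then have "x = z" using inj_onD[OF b(2)] B'(2) pl_interior_subset by blast
      then show "x \<in> (\<Union>B'\<in>\<D>'. pl_interior n B')" unfolding \<D>'_def using *(1) B'(1) z(1) by blast
    qed
    then show ?thesis using pM by blast
  qed
  moreover have "collapses_onto (M' \<inter> p -` (M - (\<Union>D\<in>\<D>. pl_interior n D))) (M' \<inter> p -` P)"
    using cov D(4) by (rule collapses_onto_lift) blast
  ultimately show ?thesis
    unfolding is_spine_def using pl_covering_vimage[OF cov cp(1)] int[OF cp(2)]
    by (intro conjI exI[of _ \<D>']) auto
qed

section \<open>Lifting simple spines and counting their vertices\<close>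

lemma pl_manifold_le_DIM:
  "pl_manifold n (M :: 'a::euclidean_space set) \<Longrightarrow> M \<noteq> {} \<Longrightarrow> n \<le> DIM('a)"
  unfolding pl_manifold_def using pl_ball_le_DIM by blast

text \<open>Inverse charts carry point types and unknotted link pairs from \<open>P\<close> up to
  its preimage, which gives the spine upstairs. Forward charts carry vertices down, which gives the
  inclusion used for counting.\<close>

lemma simple_spine_lift:
  fixes p :: "'b::euclidean_space \<Rightarrow> 'a::euclidean_space"
  assumes M: "pl_manifold n M" "pl_manifold n M'" and cov: "pl_covering d M' p M"
    and spine: "simple_spine n M P"
  shows "simple_spine n M' (M' \<inter> p -` P)"
    and "vertices (n - 1) (M' \<inter> p -` P) \<subseteq> M' \<inter> p -` vertices (n - 1) P"
    and "vertices (n - 1) P \<subseteq> M"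
proof -
  let ?P = "M' \<inter> p -` P"
  have P: "is_spine n M P" "simple_polyhedron (n - 1) P" "locally_unknotted M P"
    using spine unfolding simple_spine_def by auto
  have cp: "compact_polyhedron P" "P \<subseteq> M"
    using P(1) pl_interior_subset unfolding is_spine_def by blast+
  have chart: "\<exists>N. pl_chart p x N M' ?P M P" if "x \<in> ?P" for x
    using pl_covering_chart[OF cov cp, of x] that by blast
  have inverse_chart: "\<exists>q N. pl_chart q (p x) N M P M' ?P \<and> q (p x) = x" if x: "x \<in> ?P" for x
  proof -
    obtain N where N: "pl_chart p x N M' ?P M P" using chart x by blast
    have "inv_into N p (p x) = x" using N unfolding pl_chart_def nbhd_in_iff by simp
    then show ?thesis using pl_chart_inverse[OF N] by blast
  qed
  \<comment> \<open>A point of the preimage makes both manifolds nonempty, so each contains an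
    \<open>n\<close>-ball and its ambient space has dimension at least \<open>n\<close>.\<close>
  have dims: "n - 1 \<le> DIM('a)" "n - 1 \<le> DIM('b)" if "x \<in> ?P" for x
  proof -
    have "M \<noteq> {}" "M' \<noteq> {}" using that cp(2) by blast+
    then show "n - 1 \<le> DIM('a)" "n - 1 \<le> DIM('b)"
      using pl_manifold_le_DIM M by (metis diff_le_self order_trans)+
  qed
  have "polyhedron_dim (p ` ?P) = polyhedron_dim ?P"
  proof (rule polyhedron_dim_pl_image)
    have "pl_on M' p" using cov unfolding pl_covering_def by blast
    then show "pl_on ?P p" using pl_covering_vimage[OF cov cp(1)] by (rule pl_on_subset) blast
    fix x assume "x \<in> ?P"
    then obtain N where N: "nbhd_in M' x N" "inj_on p N"
      using chart unfolding pl_chart_def by blast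
    then obtain e where e: "e > 0" "M' \<inter> ball x e \<subseteq> N" unfolding nbhd_in_iff by blast
    then have "?P \<inter> ball x e \<subseteq> N" by blast
    with N(2) have "inj_on p (?P \<inter> ball x e)" by (rule inj_on_subset)
    then show "\<exists>U. open U \<and> x \<in> U \<and> inj_on p (?P \<inter> U)" using e(1) by (metis centre_in_ball open_ball)
  qed
  then have dim: "polyhedron_dim ?P = polyhedron_dim P"
    unfolding pl_covering_image_vimage[OF cov cp(2)] by simp
  have "simple_polyhedron (n - 1) ?P"
    unfolding simple_polyhedron_def
  proof (intro conjI ballI)
    show "compact_polyhedron ?P" using cov cp(1) by (rule pl_covering_vimage)
    show "polyhedron_dim ?P = int (n - 1)" using dim P(2) unfolding simple_polyhedron_def by simp
    fix x assume x: "x \<in> ?P"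
    then obtain k where k: "k \<le> n - 1" "point_of_type (n - 1) k P (p x)"
      using P(2) unfolding simple_polyhedron_def by blast
    obtain q N where q: "pl_chart q (p x) N M P M' ?P" "q (p x) = x" using inverse_chart[OF x] by blast
    show "\<exists>k\<le>n - 1. point_of_type (n - 1) k ?P x"
      using point_of_type_chart[OF q(1) k(2) dims(2)[OF x]] q(2) k(1) by auto
  qed
  moreover have "locally_unknotted M' ?P"
    unfolding locally_unknotted_def
  proof
    fix x assume x: "x \<in> ?P"
    then obtain L L' where L: "is_link_pair (p x) M P L L'"
        "Max {t. is_suspension_pair t L L'} = Max {t. is_suspension t L'}"
      using P(3) unfolding locally_unknotted_def by blast
    obtain q N where q: "pl_chart q (p x) N M P M' ?P" "q (p x) = x" using inverse_chart[OF x] by blast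
    show "\<exists>L L'. is_link_pair x M' ?P L L' \<and>
        Max {t. is_suspension_pair t L L'} = Max {t. is_suspension t L'}"
      using unknotted_chart[OF q(1) L] q(2) by simp
  qed
  ultimately show "simple_spine n M' ?P"
    unfolding simple_spine_def using is_spine_lift[OF cov M(1) P(1)] by blast
  show "vertices (n - 1) P \<subseteq> M" using cp(2) unfolding vertices_def point_of_type_def by blast
  show "vertices (n - 1) ?P \<subseteq> M' \<inter> p -` vertices (n - 1) P"
  proof
    fix x assume v: "x \<in> vertices (n - 1) ?P"
    then have pt: "point_of_type (n - 1) 0 ?P x" unfolding vertices_def by simp
    then have x: "x \<in> ?P" unfolding point_of_type_def by blast
    obtain N where N: "pl_chart p x N M' ?P M P" using chart[OF x] by blast
    show "x \<in> M' \<inter> p -` vertices (n - 1) P"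
      using point_of_type_chart[OF N pt dims(1)[OF x]] x unfolding vertices_def by auto
  qed
qed

lemma ecard_pl_covering_vimage:
  assumes cov: "pl_covering d M' p M" and "V \<subseteq> M" "V' \<subseteq> M' \<inter> p -` V"
  shows "ecard V' \<le> enat d * ecard V"
proof (cases "finite V")
  case True
  have fib: "finite {y \<in> M'. p y = x}" "card {y \<in> M'. p y = x} = d" if "x \<in> V" for x
    using cov assms(2) that unfolding pl_covering_def by auto
  have eq: "M' \<inter> p -` V = (\<Union>x\<in>V. {y \<in> M'. p y = x})" by blast
  have fin: "finite (M' \<inter> p -` V)" unfolding eq using True fib by blast
  have "card V' \<le> card (M' \<inter> p -` V)" using fin assms(3) by (rule card_mono)
  also have "\<dots> \<le> (\<Sum>x\<in>V. card {y \<in> M'. p y = x})" unfolding eq using True by (rule card_UN_le)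
  also have "\<dots> = d * card V" using fib by simp
  finally show ?thesis using True finite_subset[OF assms(3) fin] by (simp add: ecard_def)
next
  \<comment> \<open>As 0 times infinity is 0 in \<open>enat\<close>, positivity of \<open>d\<close>
    is what makes the right-hand side infinite.\<close>
  case False
  have "1 \<le> d" using cov unfolding pl_covering_def by blast
  then have "enat d * ecard V = \<infinity>" using False by (simp add: ecard_def zero_enat_def)
  then show ?thesis by simp
qed

theorem theorem9p1:
  fixes M :: "'a::euclidean_space set"
    and M' :: "'b::euclidean_space set"
    and p :: "'b \<Rightarrow> 'a"
    and n d :: nat
  assumes "1 \<le> n"
    and "pl_manifold n M"
    and "pl_manifold n M'"
    and "pl_covering d M' p M"
  shows "complexity n M' \<le> enat d * complexity n M"
proof (cases "{P. simple_spine n M P} = {}")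
  case True
  \<comment> \<open>Without a simple spine of \<open>M\<close> the infimum is over the empty set and
    equals infinity; multiplying by a positive \<open>d\<close> preserves this.\<close>
  have "1 \<le> d" using assms(4) unfolding pl_covering_def by blast
  then have "enat d * complexity n M = \<infinity>"
    unfolding complexity_def True by (simp add: top_enat_def zero_enat_def)
  then show ?thesis by simp
next
  case False
  \<comment> \<open>A nonempty set in \<open>enat\<close> contains its infimum, so some spine
    realizes the complexity and can be lifted.\<close>
  then have "complexity n M \<in> (\<lambda>P. ecard (vertices (n - 1) P)) ` {P. simple_spine n M P}"
    unfolding complexity_def Inf_enat_def by (auto intro: LeastI)
  then obtain P where P: "simple_spine n M P" "complexity n M = ecard (vertices (n - 1) P)" by blast
  note lift = simple_spine_lift[OF assms(2-4) P(1)]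
  have "complexity n M' \<le> ecard (vertices (n - 1) (M' \<inter> p -` P))"
    unfolding complexity_def using lift(1) by (intro INF_lower) simp
  also have "\<dots> \<le> enat d * ecard (vertices (n - 1) P)"
    using assms(4) lift(3,2) by (rule ecard_pl_covering_vimage)
  finally show ?thesis unfolding P(2) .
qed

end
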